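(* Let $G$ be a Lie group acting smoothly and transitively on a connected manifold $M$, and let $S$ be a geodesic orbit spray on $M$ (with respect to $G$). Then $S$ is invariant projectively Riemann (respectively Finsler) metrizable if and only if $S$ is invariant Riemann (respectively Finsler) metrizable. That is: there exists a $G$-invariant Riemannian (resp. Finsler) metric on $M$ whose geodesics are projectively equivalent to the geodesics of $S$ if and only if there exists a $G$-invariant Riemannian (resp. Finsler) metric on $M$ whose geodesics coincide with the geodesics of $S$.
   Context: Spray: let $M$ be a smooth finite-dimensional manifold, $J=dx^i\otimes\frac{\partial}{\partial y^i}$ the vertical endomorphism of $TTM$ and $C=y^i\frac{\partial}{\partial y^i}$ the Liouville vector field, in induced coordinates $(x^i,y^i)$ on $TM$. A spray is a smooth vector field $S$ on $TM\setminus\{0\}$ with $JS=C$ and $[C,S]=S$; locally $S=y^i\frac{\partial}{\partial x^i}+f^i(x,y)\frac{\partial}{\partial y^i}$ with $f^i$ positively homogeneous of degree $2$ in $y$. Geodesics of $S$ are the curves $\gamma$ with $\ddot x^i=f^i(x,\dot x)$. Metrics: a Finsler metric on $M$ is given by an energy function $E:TM\to\mathbb R$, smooth on $TM\setminus\{0\}$, positively homogeneous of degree $2$ in $y$, with $\big(\frac{\partial^2E}{\partial y^i\partial y^j}\big)$ positive definite on $TM\setminus\{0\}$ (no reversibility is assumed). It is a Riemannian metric if $E$ is quadratic in $y$. Its geodesics are the solutions of the Euler-Lagrange equations of $E$ (equivalently, the geodesics of the spray determined by $E$). Two families of curves are projectively equivalent if they coincide up to orientation preserving reparameterization of the curves.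 Homogeneous setting: the action is written $\lambda_g m=g\cdot m$; fix an origin $o\in M$ with stabiliser $H$, so $M\cong G/H$. Sprays, metrics and functions are called invariant if they are invariant under the action of $G$ (for a function $L$ on $TM$: $L\circ(\lambda_g)_*=L$ for all $g\in G$; a metric is invariant if its energy function is). A geodesic $\gamma$ emanating from $o$ is homogeneous if there is $X_\gamma\in\mathfrak g$ (the Lie algebra of $G$) with $\gamma(t)=\exp(tX_\gamma)\cdot o$. A spray is a geodesic orbit spray (g.o. spray) if it is $G$-invariant and every geodesic emanating from $o$ is homogeneous. *)

theory Defs
  imports "HOL-Analysis.Analysis" "HOL-Algebra.Group_Action"
begin

section \<open>Smooth maps between open subsets of Euclidean spaces\<close>

text \<open>Only meaningful for open \<open>S\<close>. Since the domain is finite dimensional, continuity of all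
  iterated directional derivatives is the usual notion of class \<open>C\<^sup>k\<close>.\<close>

fun Ck_on :: "nat \<Rightarrow> 'a set \<Rightarrow> ('a::euclidean_space \<Rightarrow> 'b::euclidean_space) \<Rightarrow> bool" where
  "Ck_on 0 S f \<longleftrightarrow> continuous_on S f"
| "Ck_on (Suc k) S f \<longleftrightarrow>
     (\<forall>x\<in>S. f differentiable (at x)) \<and> (\<forall>v. Ck_on k S (\<lambda>x. frechet_derivative f (at x) v))"

definition smooth_on :: "'a set \<Rightarrow> ('a::euclidean_space \<Rightarrow> 'b::euclidean_space) \<Rightarrow> bool" where
  "smooth_on S f \<longleftrightarrow> (\<forall>k. Ck_on k S f)"


section \<open>Manifolds\<close>

text \<open>A manifold is given by an atlas. A chart is a pair of a domain and a coordinate map (whose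
  values outside the domain are irrelevant); the underlying set and the topology of the manifold are
  those determined by the atlas.\<close>

type_synonym ('a, 'e) chart = "'a set \<times> ('a \<Rightarrow> 'e)"
type_synonym ('a, 'e) atlas = "('a, 'e) chart set"

definition points :: "('a, 'e) atlas \<Rightarrow> 'a set" where
  "points A = (\<Union>\<phi>\<in>A. fst \<phi>)"

definition chart_inv :: "('a, 'e) chart \<Rightarrow> 'e \<Rightarrow> 'a" where
  "chart_inv \<phi> = inv_into (fst \<phi>) (snd \<phi>)"

definition transition :: "('a, 'e) chart \<Rightarrow> ('a, 'e) chart \<Rightarrow> 'e \<Rightarrow> 'e" where
  "transition \<phi> \<psi> = snd \<psi> \<circ> chart_inv \<phi>"

definition manifold_topology :: "('a, 'e::euclidean_space) atlas \<Rightarrow> 'a topology" where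
  "manifold_topology A =
     topology (\<lambda>W. W \<subseteq> points A \<and> (\<forall>\<phi>\<in>A. open (snd \<phi> ` (W \<inter> fst \<phi>))))"

definition smooth_manifold :: "('a, 'e::euclidean_space) atlas \<Rightarrow> bool" where
  "smooth_manifold A \<longleftrightarrow>
     (\<forall>\<phi>\<in>A. inj_on (snd \<phi>) (fst \<phi>) \<and> open (snd \<phi> ` fst \<phi>)) \<and>
     (\<forall>\<phi>\<in>A. \<forall>\<psi>\<in>A. open (snd \<phi> ` (fst \<phi> \<inter> fst \<psi>)) \<and>
        smooth_on (snd \<phi> ` (fst \<phi> \<inter> fst \<psi>)) (transition \<phi> \<psi>)) \<and>
     Hausdorff_space (manifold_topology A) \<and>
     second_countable (manifold_topology A)"

definition euclidean_atlas :: "('e::euclidean_space, 'e) atlas" where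
  "euclidean_atlas = {(UNIV, \<lambda>x. x)}"

definition product_atlas :: "('a, 'e) atlas \<Rightarrow> ('b, 'f) atlas \<Rightarrow> ('a \<times> 'b, 'e \<times> 'f) atlas" where
  "product_atlas A B =
     (\<lambda>(\<phi>, \<psi>). (fst \<phi> \<times> fst \<psi>, map_prod (snd \<phi>) (snd \<psi>))) ` (A \<times> B)"

text \<open>Smoothness of a map on an open subset \<open>W\<close> of a manifold. The first condition on the domain of
  each local representative expresses continuity.\<close>

definition smooth_map ::
  "('a, 'e::euclidean_space) atlas \<Rightarrow> 'a set \<Rightarrow> ('b, 'f::euclidean_space) atlas \<Rightarrow> ('a \<Rightarrow> 'b) \<Rightarrow> bool"
  where
  "smooth_map A W B f \<longleftrightarrow>
     W \<subseteq> points A \<and> f ` W \<subseteq> points B \<and>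
     (\<forall>\<phi>\<in>A. \<forall>\<psi>\<in>B.
        open (snd \<phi> ` {p \<in> W \<inter> fst \<phi>. f p \<in> fst \<psi>}) \<and>
        smooth_on (snd \<phi> ` {p \<in> W \<inter> fst \<phi>. f p \<in> fst \<psi>}) (snd \<psi> \<circ> f \<circ> chart_inv \<phi>))"


section \<open>Tangent bundles\<close>

text \<open>A tangent vector at \<open>p\<close> is represented as the pair of \<open>p\<close> and the family of its coordinate
  vectors in all charts around \<open>p\<close>, which are related by the derivatives of the transition maps
  (and are set to 0 for all other charts, so that equality is equality of tangent vectors).\<close>

type_synonym ('a, 'e) tangent = "'a \<times> (('a, 'e) chart \<Rightarrow> 'e)"

definition tangent_vectors :: "('a, 'e::euclidean_space) atlas \<Rightarrow> ('a, 'e) tangent set" where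
  "tangent_vectors A = {(p, v). p \<in> points A \<and>
     (\<forall>\<phi>\<in>A. \<forall>\<psi>\<in>A. p \<in> fst \<phi> \<and> p \<in> fst \<psi> \<longrightarrow>
        v \<psi> = frechet_derivative (transition \<phi> \<psi>) (at (snd \<phi> p)) (v \<phi>)) \<and>
     (\<forall>\<phi>. \<not> (\<phi> \<in> A \<and> p \<in> fst \<phi>) \<longrightarrow> v \<phi> = 0)}"

text \<open>The chart of \<open>TM\<close> with the induced coordinates \<open>(x, y)\<close>. As the atlas of \<open>TM\<close> consists of
  these charts only, \<open>tangent_atlas (tangent_atlas A)\<close> describes \<open>TTM\<close>, the coordinates of a vector
  in \<open>TTM\<close> with respect to an induced chart being those in the basis
  \<open>\<partial>/\<partial>x\<^sup>i, \<partial>/\<partial>y\<^sup>i\<close>.\<close>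

definition tangent_chart ::
  "('a, 'e::euclidean_space) atlas \<Rightarrow> ('a, 'e) chart \<Rightarrow> (('a, 'e) tangent, 'e \<times> 'e) chart" where
  "tangent_chart A \<phi> =
     ({v \<in> tangent_vectors A. fst v \<in> fst \<phi>}, \<lambda>v. (snd \<phi> (fst v), snd v \<phi>))"

definition tangent_atlas ::
  "('a, 'e::euclidean_space) atlas \<Rightarrow> (('a, 'e) tangent, 'e \<times> 'e) atlas" where
  "tangent_atlas A = tangent_chart A ` A"

definition nonzero_tangent_vectors :: "('a, 'e::euclidean_space) atlas \<Rightarrow> ('a, 'e) tangent set"
  where
  "nonzero_tangent_vectors A = {v \<in> tangent_vectors A. snd v \<noteq> (\<lambda>_. 0)}"

definition tangent_scale :: "real \<Rightarrow> ('a, 'e::euclidean_space) tangent \<Rightarrow> ('a, 'e) tangent" where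
  "tangent_scale c v = (fst v, \<lambda>\<phi>. c *\<^sub>R snd v \<phi>)"

text \<open>The differential \<open>f\<^sub>*\<close>. It does not depend on the chart \<open>\<phi>\<close> chosen when \<open>f\<close> is smooth.\<close>

definition tangent_map ::
  "('a, 'e::euclidean_space) atlas \<Rightarrow> ('b, 'f::euclidean_space) atlas \<Rightarrow> ('a \<Rightarrow> 'b) \<Rightarrow>
   ('a, 'e) tangent \<Rightarrow> ('b, 'f) tangent" where
  "tangent_map A B f v =
     (let \<phi> = (SOME \<phi>. \<phi> \<in> A \<and> fst v \<in> fst \<phi>)
      in (f (fst v), \<lambda>\<psi>. if \<psi> \<in> B \<and> f (fst v) \<in> fst \<psi>
            then frechet_derivative (snd \<psi> \<circ> f \<circ> chart_inv \<phi>) (at (snd \<phi> (fst v))) (snd v \<phi>)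
            else 0))"

definition velocity ::
  "('a, 'e::euclidean_space) atlas \<Rightarrow> (real \<Rightarrow> 'a) \<Rightarrow> real \<Rightarrow> ('a, 'e) tangent" where
  "velocity A \<gamma> t =
     (\<gamma> t, \<lambda>\<phi>. if \<phi> \<in> A \<and> \<gamma> t \<in> fst \<phi> then vector_derivative (snd \<phi> \<circ> \<gamma>) (at t) else 0)"


section \<open>Vector fields and sprays\<close>

definition smooth_vector_field ::
  "('a, 'e::euclidean_space) atlas \<Rightarrow> 'a set \<Rightarrow> ('a \<Rightarrow> ('a, 'e) tangent) \<Rightarrow> bool" where
  "smooth_vector_field A W X \<longleftrightarrow>
     smooth_map A W (tangent_atlas A) X \<and> (\<forall>p\<in>W. fst (X p) = p)"

definition vf_coords ::
  "('a, 'e::euclidean_space) chart \<Rightarrow> ('a \<Rightarrow> ('a, 'e) tangent) \<Rightarrow> 'e \<Rightarrow> 'e" where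
  "vf_coords \<phi> X x = snd (X (chart_inv \<phi> x)) \<phi>"

text \<open>\<open>[X, Y]\<^sup>i = X\<^sup>j \<partial>Y\<^sup>i/\<partial>x\<^sup>j - Y\<^sup>j \<partial>X\<^sup>i/\<partial>x\<^sup>j\<close>.\<close>

definition lie_bracket ::
  "('a, 'e::euclidean_space) atlas \<Rightarrow> ('a \<Rightarrow> ('a, 'e) tangent) \<Rightarrow> ('a \<Rightarrow> ('a, 'e) tangent) \<Rightarrow>
   'a \<Rightarrow> ('a, 'e) tangent" where
  "lie_bracket A X Y p = (p, \<lambda>\<phi>. if \<phi> \<in> A \<and> p \<in> fst \<phi> then
       (let x = snd \<phi> p in
          frechet_derivative (vf_coords \<phi> Y) (at x) (vf_coords \<phi> X x) -
          frechet_derivative (vf_coords \<phi> X) (at x) (vf_coords \<phi> Y x))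
     else 0)"

definition vertical_endomorphism ::
  "(('a, 'e::euclidean_space) tangent, 'e \<times> 'e) tangent \<Rightarrow> (('a, 'e) tangent, 'e \<times> 'e) tangent"
  where
  "vertical_endomorphism w = (fst w, \<lambda>\<Phi>. (0, fst (snd w \<Phi>)))"

definition liouville_field ::
  "('a, 'e::euclidean_space) atlas \<Rightarrow> ('a, 'e) tangent \<Rightarrow> (('a, 'e) tangent, 'e \<times> 'e) tangent"
  where
  "liouville_field A v =
     (v, \<lambda>\<Phi>. if \<Phi> \<in> tangent_atlas A \<and> v \<in> fst \<Phi> then (0, snd (snd \<Phi> v)) else 0)"

type_synonym ('a, 'e) spray_field = "('a, 'e) tangent \<Rightarrow> (('a, 'e) tangent, 'e \<times> 'e) tangent"

definition spray :: "('a, 'e::euclidean_space) atlas \<Rightarrow> ('a, 'e) spray_field \<Rightarrow> bool" where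
  "spray A S \<longleftrightarrow>
     smooth_vector_field (tangent_atlas A) (nonzero_tangent_vectors A) S \<and>
     (\<forall>v\<in>nonzero_tangent_vectors A.
        vertical_endomorphism (S v) = liouville_field A v \<and>
        lie_bracket (tangent_atlas A) (liouville_field A) S v = S v)"

text \<open>The coefficients \<open>f\<^sup>i\<close> in \<open>S = y\<^sup>i \<partial>/\<partial>x\<^sup>i + f\<^sup>i \<partial>/\<partial>y\<^sup>i\<close>.\<close>

definition spray_coeff ::
  "('a, 'e::euclidean_space) atlas \<Rightarrow> ('a, 'e) spray_field \<Rightarrow> ('a, 'e) chart \<Rightarrow>
   ('a, 'e) tangent \<Rightarrow> 'e" where
  "spray_coeff A S \<phi> v = snd (snd (S v) (tangent_chart A \<phi>))"


section \<open>Curves and geodesics\<close>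

text \<open>A parametrized curve is a pair of its parameter interval and a map (whose values outside the
  interval are irrelevant). Sprays and energy functions need only be smooth away from the zero
  section, so geodesics are regular curves.\<close>

type_synonym 'a curve = "real set \<times> (real \<Rightarrow> 'a)"

definition regular_curve :: "('a, 'e::euclidean_space) atlas \<Rightarrow> 'a curve \<Rightarrow> bool" where
  "regular_curve A = (\<lambda>(I, \<gamma>).
     open I \<and> is_interval I \<and> I \<noteq> {} \<and> smooth_map euclidean_atlas I A \<gamma> \<and>
     (\<forall>t\<in>I. velocity A \<gamma> t \<in> nonzero_tangent_vectors A))"

definition spray_geodesics ::
  "('a, 'e::euclidean_space) atlas \<Rightarrow> ('a, 'e) spray_field \<Rightarrow> 'a curve set" where
  "spray_geodesics A S = {(I, \<gamma>). regular_curve A (I, \<gamma>) \<and>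
     (\<forall>t\<in>I. \<forall>\<phi>\<in>A. \<gamma> t \<in> fst \<phi> \<longrightarrow>
        ((\<lambda>s. vector_derivative (snd \<phi> \<circ> \<gamma>) (at s))
           has_vector_derivative spray_coeff A S \<phi> (velocity A \<gamma> t)) (at t))}"

definition orientation_preserving_reparam :: "(real \<Rightarrow> real) \<Rightarrow> real set \<Rightarrow> real set \<Rightarrow> bool" where
  "orientation_preserving_reparam \<theta> J I \<longleftrightarrow>
     bij_betw \<theta> J I \<and> smooth_on J \<theta> \<and> (\<forall>t\<in>J. deriv \<theta> t > 0)"

definition projectively_equivalent :: "'a curve set \<Rightarrow> 'a curve set \<Rightarrow> bool" where
  "projectively_equivalent \<F> \<G> \<longleftrightarrow>
     (\<forall>(I, \<gamma>)\<in>\<F>. \<exists>J \<theta>. orientation_preserving_reparam \<theta> J I \<and> (J, \<gamma> \<circ> \<theta>) \<in> \<G>) \<and>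
     (\<forall>(I, \<gamma>)\<in>\<G>. \<exists>J \<theta>. orientation_preserving_reparam \<theta> J I \<and> (J, \<gamma> \<circ> \<theta>) \<in> \<F>)"


section \<open>Finsler and Riemannian metrics\<close>

type_synonym ('a, 'e) energy = "('a, 'e) tangent \<Rightarrow> real"

definition energy_coords ::
  "('a, 'e::euclidean_space) atlas \<Rightarrow> ('a, 'e) energy \<Rightarrow> ('a, 'e) chart \<Rightarrow> 'e \<times> 'e \<Rightarrow> real" where
  "energy_coords A E \<phi> = E \<circ> chart_inv (tangent_chart A \<phi>)"

definition dE_dx ::
  "('a, 'e::euclidean_space) atlas \<Rightarrow> ('a, 'e) energy \<Rightarrow> ('a, 'e) chart \<Rightarrow> 'e \<Rightarrow> 'e \<times> 'e \<Rightarrow> real"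
  where
  "dE_dx A E \<phi> i z = frechet_derivative (energy_coords A E \<phi>) (at z) (i, 0)"

definition dE_dy ::
  "('a, 'e::euclidean_space) atlas \<Rightarrow> ('a, 'e) energy \<Rightarrow> ('a, 'e) chart \<Rightarrow> 'e \<Rightarrow> 'e \<times> 'e \<Rightarrow> real"
  where
  "dE_dy A E \<phi> i z = frechet_derivative (energy_coords A E \<phi>) (at z) (0, i)"

definition fibre_hessian ::
  "('a, 'e::euclidean_space) atlas \<Rightarrow> ('a, 'e) energy \<Rightarrow> ('a, 'e) chart \<Rightarrow> 'e \<Rightarrow> 'e \<Rightarrow> 'e \<times> 'e \<Rightarrow> real"
  where
  "fibre_hessian A E \<phi> i j z = frechet_derivative (dE_dy A E \<phi> j) (at z) (0, i)"

definition finsler_metric :: "('a, 'e::euclidean_space) atlas \<Rightarrow> ('a, 'e) energy \<Rightarrow> bool" where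
  "finsler_metric A E \<longleftrightarrow>
     smooth_map (tangent_atlas A) (nonzero_tangent_vectors A) euclidean_atlas E \<and>
     (\<forall>v\<in>tangent_vectors A. \<forall>c>0. E (tangent_scale c v) = c\<^sup>2 * E v) \<and>
     (\<forall>v\<in>nonzero_tangent_vectors A. \<forall>\<phi>\<in>A. fst v \<in> fst \<phi> \<longrightarrow>
        (\<forall>u. u \<noteq> 0 \<longrightarrow>
           (\<Sum>i\<in>Basis. \<Sum>j\<in>Basis.
              fibre_hessian A E \<phi> i j (snd (tangent_chart A \<phi>) v) * (u \<bullet> i) * (u \<bullet> j)) > 0))"

definition riemannian_metric :: "('a, 'e::euclidean_space) atlas \<Rightarrow> ('a, 'e) energy \<Rightarrow> bool" where
  "riemannian_metric A E \<longleftrightarrow>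
     finsler_metric A E \<and>
     (\<forall>\<phi>\<in>A. \<forall>p\<in>fst \<phi>. \<exists>b. bilinear b \<and>
        (\<forall>v\<in>tangent_vectors A. fst v = p \<longrightarrow> E v = b (snd v \<phi>) (snd v \<phi>)))"

text \<open>The Euler-Lagrange equations \<open>d/dt (\<partial>E/\<partial>y\<^sup>i) = \<partial>E/\<partial>x\<^sup>i\<close> along the
  velocity curve.\<close>

definition energy_geodesics ::
  "('a, 'e::euclidean_space) atlas \<Rightarrow> ('a, 'e) energy \<Rightarrow> 'a curve set" where
  "energy_geodesics A E = {(I, \<gamma>). regular_curve A (I, \<gamma>) \<and>
     (\<forall>t\<in>I. \<forall>\<phi>\<in>A. \<gamma> t \<in> fst \<phi> \<longrightarrow> (\<forall>i\<in>Basis.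
        ((\<lambda>s. dE_dy A E \<phi> i (snd (tangent_chart A \<phi>) (velocity A \<gamma> s)))
           has_real_derivative dE_dx A E \<phi> i (snd (tangent_chart A \<phi>) (velocity A \<gamma> t))) (at t)))}"


section \<open>Lie groups, actions and invariance\<close>

definition lie_group ::
  "('g, 'x) monoid_scheme \<Rightarrow> ('g, 'h::euclidean_space) atlas \<Rightarrow> bool" where
  "lie_group G \<A> \<longleftrightarrow>
     group G \<and> smooth_manifold \<A> \<and> points \<A> = carrier G \<and>
     smooth_map (product_atlas \<A> \<A>) (carrier G \<times> carrier G) \<A> (\<lambda>(g, h). g \<otimes>\<^bsub>G\<^esub> h) \<and>
     smooth_map \<A> (carrier G) \<A> (\<lambda>g. inv\<^bsub>G\<^esub> g)"

definition smooth_transitive_action ::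
  "('g, 'x) monoid_scheme \<Rightarrow> ('g, 'h::euclidean_space) atlas \<Rightarrow> ('a, 'e::euclidean_space) atlas \<Rightarrow>
   ('g \<Rightarrow> 'a \<Rightarrow> 'a) \<Rightarrow> bool" where
  "smooth_transitive_action G \<A> A act \<longleftrightarrow>
     transitive_action G (points A) act \<and>
     smooth_map (product_atlas \<A> A) (carrier G \<times> points A) A (\<lambda>(g, m). act g m)"

definition lie_algebra ::
  "('g, 'x) monoid_scheme \<Rightarrow> ('g, 'h::euclidean_space) atlas \<Rightarrow> ('g, 'h) tangent set" where
  "lie_algebra G \<A> = {X \<in> tangent_vectors \<A>. fst X = \<one>\<^bsub>G\<^esub>}"

text \<open>\<open>c\<close> is the curve \<open>t \<mapsto> exp (t X)\<close>: by definition of the exponential map, this is the smooth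
  homomorphism from the additive group of reals to \<open>G\<close> with initial velocity \<open>X\<close>.\<close>

definition is_exp_curve ::
  "('g, 'x) monoid_scheme \<Rightarrow> ('g, 'h::euclidean_space) atlas \<Rightarrow> ('g, 'h) tangent \<Rightarrow>
   (real \<Rightarrow> 'g) \<Rightarrow> bool" where
  "is_exp_curve G \<A> X c \<longleftrightarrow>
     smooth_map euclidean_atlas UNIV \<A> c \<and>
     (\<forall>s t. c (s + t) = c s \<otimes>\<^bsub>G\<^esub> c t) \<and>
     velocity \<A> c 0 = X"

definition homogeneous_curve ::
  "('g, 'x) monoid_scheme \<Rightarrow> ('g, 'h::euclidean_space) atlas \<Rightarrow> ('g \<Rightarrow> 'a \<Rightarrow> 'a) \<Rightarrow> 'a \<Rightarrow>
   'a curve \<Rightarrow> bool" where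
  "homogeneous_curve G \<A> act p0 = (\<lambda>(I, \<gamma>).
     \<exists>X\<in>lie_algebra G \<A>. \<exists>c. is_exp_curve G \<A> X c \<and> (\<forall>t\<in>I. \<gamma> t = act (c t) p0))"

definition invariant_spray ::
  "('g, 'x) monoid_scheme \<Rightarrow> ('a, 'e::euclidean_space) atlas \<Rightarrow> ('g \<Rightarrow> 'a \<Rightarrow> 'a) \<Rightarrow>
   ('a, 'e) spray_field \<Rightarrow> bool" where
  "invariant_spray G A act S \<longleftrightarrow>
     (\<forall>g\<in>carrier G. \<forall>v\<in>nonzero_tangent_vectors A.
        S (tangent_map A A (act g) v) =
        tangent_map (tangent_atlas A) (tangent_atlas A) (tangent_map A A (act g)) (S v))"

definition invariant_energy ::
  "('g, 'x) monoid_scheme \<Rightarrow> ('a, 'e::euclidean_space) atlas \<Rightarrow> ('g \<Rightarrow> 'a \<Rightarrow> 'a) \<Rightarrow>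
   ('a, 'e) energy \<Rightarrow> bool" where
  "invariant_energy G A act E \<longleftrightarrow>
     (\<forall>g\<in>carrier G. \<forall>v\<in>tangent_vectors A. E (tangent_map A A (act g) v) = E v)"

definition geodesic_orbit_spray ::
  "('g, 'x) monoid_scheme \<Rightarrow> ('g, 'h::euclidean_space) atlas \<Rightarrow> ('a, 'e::euclidean_space) atlas \<Rightarrow>
   ('g \<Rightarrow> 'a \<Rightarrow> 'a) \<Rightarrow> 'a \<Rightarrow> ('a, 'e) spray_field \<Rightarrow> bool" where
  "geodesic_orbit_spray G \<A> A act p0 S \<longleftrightarrow>
     spray A S \<and> invariant_spray G A act S \<and>
     (\<forall>(I, \<gamma>)\<in>spray_geodesics A S.
        0 \<in> I \<and> \<gamma> 0 = p0 \<longrightarrow> homogeneous_curve G \<A> act p0 (I, \<gamma>))"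

text \<open>The parameter \<open>P\<close> below is \<open>riemannian_metric\<close> or \<open>finsler_metric\<close>.\<close>

definition invariant_metrizable ::
  "(('a, 'e) atlas \<Rightarrow> ('a, 'e) energy \<Rightarrow> bool) \<Rightarrow> ('g, 'x) monoid_scheme \<Rightarrow>
   ('a, 'e::euclidean_space) atlas \<Rightarrow> ('g \<Rightarrow> 'a \<Rightarrow> 'a) \<Rightarrow> ('a, 'e) spray_field \<Rightarrow> bool" where
  "invariant_metrizable P G A act S \<longleftrightarrow>
     (\<exists>E. P A E \<and> invariant_energy G A act E \<and> energy_geodesics A E = spray_geodesics A S)"

definition invariant_projectively_metrizable ::
  "(('a, 'e) atlas \<Rightarrow> ('a, 'e) energy \<Rightarrow> bool) \<Rightarrow> ('g, 'x) monoid_scheme \<Rightarrow>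
   ('a, 'e::euclidean_space) atlas \<Rightarrow> ('g \<Rightarrow> 'a \<Rightarrow> 'a) \<Rightarrow> ('a, 'e) spray_field \<Rightarrow> bool" where
  "invariant_projectively_metrizable P G A act S \<longleftrightarrow>
     (\<exists>E. P A E \<and> invariant_energy G A act E \<and>
        projectively_equivalent (energy_geodesics A E) (spray_geodesics A S))"

end

theory Submission
  imports Defs
begin

text \<open>If the geodesics of an invariant energy function \<open>E\<close> are projectively equivalent to those of
  a geodesic orbit spray \<open>S\<close>, then the two families of geodesics are equal, so that the same \<open>E\<close>
  metrizes \<open>S\<close>. The converse is immediate, since a family of curves is projectively equivalent to
  itself.

  The reason is that \<open>E\<close> is constant along the geodesics of either family. For the geodesics of
  \<open>E\<close> this is conservation of energy (\<open>energy_constant_along_energy_geodesic\<close>). A geodesic of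
  \<open>S\<close> through the origin is an orbit \<open>exp (t X) \<cdot> p0\<close>, so its velocities are translates of each
  other and have the same energy; as \<open>S\<close> is invariant and the action is transitive, every geodesic
  of \<open>S\<close> is a translate of one through the origin (\<open>energy_constant_along_spray_geodesic\<close>).

  Now let \<open>\<gamma>\<close> be a geodesic of one family and \<open>\<gamma> \<circ> \<theta>\<close> a geodesic of the other one. The energy of
  the velocity of \<open>\<gamma> \<circ> \<theta>\<close> is \<open>\<theta>'\<^sup>2\<close> times that of \<open>\<gamma>\<close>, both are constant, and they are positive
  because \<open>E\<close> is positive on nonzero vectors (\<open>energy_positive\<close>). Hence \<open>\<theta>\<close> is affine
  (\<open>reparam_affine\<close>). Both families are closed under increasing affine reparametrization, by the
  homogeneity of \<open>E\<close> (\<open>energy_geodesic_affine\<close>) and by the homogeneity of the coefficients of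
  \<open>S\<close>, which is what \<open>[C, S] = S\<close> expresses (\<open>spray_geodesic_affine\<close>). So \<open>\<gamma>\<close> belongs to both
  families.

  That translates of geodesics of \<open>S\<close> are geodesics of \<open>S\<close> (\<open>spray_geodesic_image\<close>) rests on the
  chain rule for velocities in the tangent bundle and in the second tangent bundle.\<close>

section \<open>Calculus of \<open>C\<^sup>k\<close> maps\<close>

text \<open>The derivatives are those of the map on the ambient space; openness of the domain is what makes
  \<open>Ck_on\<close> depend on the values there only.\<close>

lemma Ck_on_cong:
  assumes "open S" "Ck_on k S f" "\<And>x. x \<in> S \<Longrightarrow> f x = g x"
  shows "Ck_on k S g"
  using assms(2,3)
proof (induction k arbitrary: f g)
  case 0
  then show ?case using continuous_on_eq[of S f g] by simp
next
  case (Suc k)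
  have "g differentiable (at x)" if "x \<in> S" for x
  proof -
    have "f differentiable (at x)" using Suc.prems(1) that by simp
    then show ?thesis
      unfolding differentiable_def
      using has_derivative_transform_within_open[where f=f and g=g, OF _ assms(1) that Suc.prems(2)] by blast
  qed
  moreover have "Ck_on k S (\<lambda>x. frechet_derivative g (at x) v)" for v
  proof (rule Suc.IH)
    show "Ck_on k S (\<lambda>x. frechet_derivative f (at x) v)"
      using Suc.prems(1) by simp
    show "frechet_derivative f (at x) v = frechet_derivative g (at x) v" if "x \<in> S" for x
      using frechet_derivative_transform_within_open[of f x S g] Suc.prems assms(1) that by simp
  qed
  ultimately show ?case by simp
qed

lemma Ck_on_subset: "Ck_on k T f \<Longrightarrow> S \<subseteq> T \<Longrightarrow> Ck_on k S f"
proof (induction k arbitrary: f)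
  case 0
  then show ?case using continuous_on_subset[of T f S] by simp
next
  case (Suc k)
  then show ?case by auto
qed

lemma Ck_on_Suc_imp_Ck_on: "Ck_on (Suc k) S f \<Longrightarrow> Ck_on k S f"
proof (induction k arbitrary: f)
  case 0
  then show ?case
    by (simp add: differentiable_imp_continuous_on differentiable_at_imp_differentiable_on)
next
  case (Suc k)
  then show ?case by auto
qed

lemma Ck_on_locally:
  assumes "\<And>x. x \<in> S \<Longrightarrow> \<exists>U. open U \<and> x \<in> U \<and> Ck_on k U f"
  shows "Ck_on k S f"
  using assms
proof (induction k arbitrary: f)
  case 0
  have "isCont f x" if "x \<in> S" for x
    using 0[OF that] continuous_on_eq_continuous_at by auto
  then show ?case by (simp add: continuous_at_imp_continuous_on)
next
  case (Suc k)
  have "Ck_on k S (\<lambda>x. frechet_derivative f (at x) v)" for v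
  proof (rule Suc.IH)
    fix x assume "x \<in> S"
    from Suc.prems[OF this] show "\<exists>U. open U \<and> x \<in> U \<and> Ck_on k U (\<lambda>x. frechet_derivative f (at x) v)"
      by auto
  qed
  moreover have "f differentiable (at x)" if "x \<in> S" for x
    using Suc.prems[OF that] by auto
  ultimately show ?case by simp
qed

lemma Ck_on_const: "Ck_on k S (\<lambda>x. c)"
proof (induction k arbitrary: c)
  case 0
  then show ?case by simp
next
  case (Suc k)
  have "frechet_derivative (\<lambda>x::'a. c) (at x) v = 0" for x v
    by simp
  then show ?case using Suc by simp
qed

lemma Ck_on_bounded_linear_compose:
  assumes "open S" "bounded_linear L" "Ck_on k S f"
  shows "Ck_on k S (\<lambda>x. L (f x))"
  using assms(3)
proof (induction k arbitrary: f)
  case 0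
  then show ?case using assms(2)
    by (simp add: bounded_linear.continuous_on)
next
  case (Suc k)
  have D: "((\<lambda>x. L (f x)) has_derivative (\<lambda>v. L (frechet_derivative f (at x) v))) (at x)"
    if "x \<in> S" for x
  proof (rule bounded_linear.has_derivative[OF assms(2)])
    show "(f has_derivative frechet_derivative f (at x)) (at x)"
      using Suc.prems that by (simp flip: frechet_derivative_works)
  qed
  have "Ck_on k S (\<lambda>x. frechet_derivative (\<lambda>x. L (f x)) (at x) v)" for v
  proof (rule Ck_on_cong[OF assms(1)])
    show "Ck_on k S (\<lambda>x. L (frechet_derivative f (at x) v))"
      using Suc by simp
  qed (simp add: frechet_derivative_at[OF D, symmetric])
  moreover note differentiableI[OF D]
  ultimately show ?case by simp
qed

lemma Ck_on_add:
  assumes "open S" "Ck_on k S f" "Ck_on k S g"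
  shows "Ck_on k S (\<lambda>x. f x + g x)"
  using assms(2,3)
proof (induction k arbitrary: f g)
  case 0
  then show ?case by (simp add: continuous_on_add continuous_on_scaleR)
next
  case (Suc k)
  have D: "((\<lambda>x. f x + g x) has_derivative
      (\<lambda>v. frechet_derivative f (at x) v + frechet_derivative g (at x) v)) (at x)"
    if "x \<in> S" for x
    using Suc.prems that
    by (intro has_derivative_add) (simp_all flip: frechet_derivative_works)
  have "Ck_on k S (\<lambda>x. frechet_derivative (\<lambda>x. f x + g x) (at x) v)" for v
  proof (rule Ck_on_cong[OF assms(1)])
    show "Ck_on k S (\<lambda>x. frechet_derivative f (at x) v + frechet_derivative g (at x) v)"
      using Suc by simp
  qed (simp add: frechet_derivative_at[OF D, symmetric])
  moreover note differentiableI[OF D]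
  ultimately show ?case by simp
qed

lemma Ck_on_sum:
  assumes "open S" "finite B" "\<And>b. b \<in> B \<Longrightarrow> Ck_on k S (f b)"
  shows "Ck_on k S (\<lambda>x. \<Sum>b\<in>B. f b x)"
  using assms(2,3)
  by (induction B rule: finite_induct) (auto intro: Ck_on_const Ck_on_add[OF assms(1)])

lemma Ck_on_scaleR:
  fixes f :: "'a::euclidean_space \<Rightarrow> real" and g :: "'a \<Rightarrow> 'b::euclidean_space"
  assumes "open S" "Ck_on k S f" "Ck_on k S g"
  shows "Ck_on k S (\<lambda>x. f x *\<^sub>R g x)"
  using assms(2,3)
proof (induction k arbitrary: f g)
  case 0
  then show ?case by (simp add: continuous_on_add continuous_on_scaleR)
next
  case (Suc k)
  have D: "((\<lambda>x. f x *\<^sub>R g x) has_derivative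
      (\<lambda>v. f x *\<^sub>R frechet_derivative g (at x) v + frechet_derivative f (at x) v *\<^sub>R g x)) (at x)"
    if "x \<in> S" for x
    using Suc.prems that
    by (intro has_derivative_scaleR) (simp_all flip: frechet_derivative_works)
  have "Ck_on k S (\<lambda>x. frechet_derivative (\<lambda>x. f x *\<^sub>R g x) (at x) v)" for v
  proof (rule Ck_on_cong[OF assms(1)])
    show "Ck_on k S (\<lambda>x. f x *\<^sub>R frechet_derivative g (at x) v +
        frechet_derivative f (at x) v *\<^sub>R g x)"
      using Suc Ck_on_Suc_imp_Ck_on[OF Suc.prems(1)] Ck_on_Suc_imp_Ck_on[OF Suc.prems(2)]
      by (intro Ck_on_add[OF assms(1)]) simp_all
  qed (simp add: frechet_derivative_at[OF D, symmetric])
  moreover note differentiableI[OF D]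
  ultimately show ?case by simp
qed

lemma linear_eq_sum_Basis:
  fixes L :: "'a::euclidean_space \<Rightarrow> 'b::real_vector"
  assumes "linear L"
  shows "L y = (\<Sum>b\<in>Basis. (y \<bullet> b) *\<^sub>R L b)"
proof -
  have "L y = L (\<Sum>b\<in>Basis. (y \<bullet> b) *\<^sub>R b)"
    by (simp add: euclidean_representation)
  then show ?thesis
    by (simp add: linear_sum[OF assms] linear_cmul[OF assms])
qed

text \<open>In the expansion \<open>D(g \<circ> f)\<^sub>x v = \<Sum>\<^sub>b (Df\<^sub>x v \<bullet> b) Dg\<^bsub>f x\<^esub> b\<close> every factor is of class
  \<open>C\<^sup>k\<close> or a composite to which the induction hypothesis applies, so the closure under sums and
  products established above yields the step.\<close>

lemma Ck_on_compose:
  fixes f :: "'a::euclidean_space \<Rightarrow> 'b::euclidean_space"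
    and g :: "'b \<Rightarrow> 'c::euclidean_space"
  assumes "open S" "open T" "f ` S \<subseteq> T" "Ck_on k S f" "Ck_on k T g"
  shows "Ck_on k S (g \<circ> f)"
  using assms(4,5)
proof (induction k arbitrary: g)
  case 0
  then show ?case using assms(3) continuous_on_compose[of S f g] continuous_on_subset[of T g "f ` S"]
    by simp
next
  case (Suc k)
  have D: "frechet_derivative (g \<circ> f) (at x) v =
      (\<Sum>b\<in>Basis. (frechet_derivative f (at x) v \<bullet> b) *\<^sub>R frechet_derivative g (at (f x)) b)"
    and d: "g \<circ> f differentiable (at x)"
    if "x \<in> S" for x v
  proof -
    have fg: "f differentiable (at x)" "g differentiable (at (f x))"
      using Suc.prems that assms(3) by auto
    then show "g \<circ> f differentiable (at x)"
      by (rule differentiable_chain_at)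
    have "linear (frechet_derivative g (at (f x)))"
      by (rule linear_frechet_derivative[OF fg(2)])
    from linear_eq_sum_Basis[OF this, of "frechet_derivative f (at x) v"] show "frechet_derivative (g \<circ> f) (at x) v =
      (\<Sum>b\<in>Basis. (frechet_derivative f (at x) v \<bullet> b) *\<^sub>R frechet_derivative g (at (f x)) b)"
      unfolding frechet_derivative_compose[OF fg] by (simp only: comp_def)
  qed
  have "Ck_on k S (\<lambda>x. frechet_derivative (g \<circ> f) (at x) v)" for v
  proof (rule Ck_on_cong[OF assms(1)])
    show "Ck_on k S (\<lambda>x. \<Sum>b\<in>Basis. (frechet_derivative f (at x) v \<bullet> b) *\<^sub>R
        ((\<lambda>z. frechet_derivative g (at z) b) \<circ> f) x)"
      using Suc.prems Ck_on_Suc_imp_Ck_on[OF Suc.prems(1)]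
      by (intro Ck_on_sum[OF assms(1)] finite_Basis Ck_on_scaleR[OF assms(1)] Suc.IH
          Ck_on_bounded_linear_compose[OF assms(1) bounded_linear_inner_left]) simp_all
  qed (simp add: D)
  then show ?case using d by (simp add: comp_def)
qed

lemma Ck_on_affine: "Ck_on k S (\<lambda>t::real. a * t + b)"
proof (cases k)
  case 0
  then show ?thesis by (simp add: continuous_on_add continuous_on_mult_left)
next
  case (Suc n)
  have D: "((\<lambda>t. a * t + b) has_derivative (\<lambda>v. a * v)) (at x)" for x
    by (auto intro!: derivative_eq_intros)
  have "frechet_derivative (\<lambda>t. a * t + b) (at x) v = a * v"
    "(\<lambda>t. a * t + b) differentiable (at x)" for x v
    by (simp_all flip: frechet_derivative_at[OF D] add: differentiableI[OF D])
  then show ?thesis by (simp add: Suc Ck_on_const)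
qed

lemma smooth_on_cong:
  "open S \<Longrightarrow> smooth_on S f \<Longrightarrow> (\<And>x. x \<in> S \<Longrightarrow> f x = g x) \<Longrightarrow> smooth_on S g"
  by (simp add: smooth_on_def Ck_on_cong[where f=f and g=g])

lemma smooth_on_subset: "smooth_on T f \<Longrightarrow> S \<subseteq> T \<Longrightarrow> smooth_on S f"
  by (simp add: smooth_on_def Ck_on_subset[where T=T])

lemma smooth_on_locally:
  assumes "\<And>x. x \<in> S \<Longrightarrow> \<exists>U. open U \<and> x \<in> U \<and> smooth_on U f"
  shows "smooth_on S f"
  unfolding smooth_on_def
proof (intro allI Ck_on_locally)
  fix k x assume "x \<in> S"
  from assms[OF this] show "\<exists>U. open U \<and> x \<in> U \<and> Ck_on k U f"
    by (auto simp: smooth_on_def)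
qed

lemma smooth_on_compose:
  "open S \<Longrightarrow> open T \<Longrightarrow> f ` S \<subseteq> T \<Longrightarrow> smooth_on S f \<Longrightarrow> smooth_on T g \<Longrightarrow> smooth_on S (g \<circ> f)"
  by (simp add: smooth_on_def Ck_on_compose[where T=T])

lemma smooth_on_imp_Ck_on_Suc: "smooth_on S f \<Longrightarrow> Ck_on (Suc k) S f"
  by (simp only: smooth_on_def)

lemma smooth_on_imp_differentiable:
  assumes "smooth_on S f" "x \<in> S" shows "f differentiable (at x)"
  using smooth_on_imp_Ck_on_Suc[OF assms(1), of 0] assms(2) by simp

lemma smooth_on_imp_continuous_on:
  assumes "smooth_on S f" shows "continuous_on S f"
  using assms[unfolded smooth_on_def, rule_format, of 0] by simp

lemma smooth_on_frechet_derivative: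
  assumes "smooth_on S f" shows "smooth_on S (\<lambda>x. frechet_derivative f (at x) v)"
  unfolding smooth_on_def
proof
  show "Ck_on k S (\<lambda>x. frechet_derivative f (at x) v)" for k
    using smooth_on_imp_Ck_on_Suc[OF assms, of k] by simp
qed

lemma smooth_on_affine: "smooth_on S (\<lambda>t::real. a * t + b)"
  by (simp add: smooth_on_def Ck_on_affine)

section \<open>Charts and tangent vectors\<close>

lemma chart_inv_left: "inj_on (snd \<phi>) (fst \<phi>) \<Longrightarrow> p \<in> fst \<phi> \<Longrightarrow> chart_inv \<phi> (snd \<phi> p) = p"
  by (simp add: chart_inv_def)

lemma chart_inv_mem: "x \<in> snd \<phi> ` fst \<phi> \<Longrightarrow> chart_inv \<phi> x \<in> fst \<phi>"
  unfolding chart_inv_def by (rule inv_into_into)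

lemma chart_inv_right: "x \<in> snd \<phi> ` fst \<phi> \<Longrightarrow> snd \<phi> (chart_inv \<phi> x) = x"
  unfolding chart_inv_def by (rule f_inv_into_f)

lemma frechet_derivative_cong_open:
  assumes "open U" "x \<in> U" "\<And>z. z \<in> U \<Longrightarrow> f z = g z"
  shows "frechet_derivative f (at x) = frechet_derivative g (at x)"
proof -
  have "(f has_derivative D) (at x) \<longleftrightarrow> (g has_derivative D) (at x)" for D
    using has_derivative_transform_within_open[where f=f and g=g, OF _ assms]
      has_derivative_transform_within_open[where f=g and g=f, OF _ assms(1,2) assms(3)[symmetric]]
    by blast
  then show ?thesis unfolding frechet_derivative_def by simp
qed

lemma vector_derivative_cong_open:
  assumes "open U" "x \<in> U" "\<And>z. z \<in> U \<Longrightarrow> f z = g z"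
  shows "vector_derivative f (at x) = vector_derivative g (at x)"
proof -
  have "(f has_vector_derivative D) (at x) \<longleftrightarrow> (g has_vector_derivative D) (at x)" for D
    using has_vector_derivative_transform_within_open[where f=f and g=g, OF _ assms]
      has_vector_derivative_transform_within_open[where f=g and g=f, OF _ assms(1,2) assms(3)[symmetric]]
    by blast
  then show ?thesis unfolding vector_derivative_def by simp
qed

lemma vector_derivative_eq_frechet_derivative:
  assumes "f differentiable (at t)"
  shows "vector_derivative f (at t) = frechet_derivative f (at t) 1"
  using assms vector_derivative_works vector_derivative_at frechet_derivative_at
  by (metis has_vector_derivative_def scaleR_one)

lemma vector_derivative_compose:
  assumes "c differentiable (at t)" "F differentiable (at (c t))"
  shows "vector_derivative (F \<circ> c) (at t) = frechet_derivative F (at (c t)) (vector_derivative c (at t))"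
  using vector_derivative_eq_frechet_derivative assms frechet_derivative_compose[OF assms]
    differentiable_chain_at[OF assms]
  by (metis comp_apply)

text \<open>The chain rule for velocities. It is used for curves in a manifold and once more for their velocity
  curves, viewed as curves in the tangent bundle.\<close>

lemma velocity_compose:
  assumes inj: "\<And>\<phi>. \<phi> \<in> A \<Longrightarrow> inj_on (snd \<phi>) (fst \<phi>)"
    and point: "\<gamma> t \<in> points A"
    and near: "\<And>\<phi>. \<phi> \<in> A \<Longrightarrow> \<gamma> t \<in> fst \<phi> \<Longrightarrow> \<exists>U. open U \<and> t \<in> U \<and> \<gamma> ` U \<subseteq> fst \<phi>"
    and curve: "\<And>\<phi>. \<phi> \<in> A \<Longrightarrow> \<gamma> t \<in> fst \<phi> \<Longrightarrow> snd \<phi> \<circ> \<gamma> differentiable (at t)"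
    and map: "\<And>\<phi> \<psi>. \<phi> \<in> A \<Longrightarrow> \<psi> \<in> B \<Longrightarrow> \<gamma> t \<in> fst \<phi> \<Longrightarrow> f (\<gamma> t) \<in> fst \<psi> \<Longrightarrow>
      snd \<psi> \<circ> f \<circ> chart_inv \<phi> differentiable (at (snd \<phi> (\<gamma> t)))"
  shows "velocity B (f \<circ> \<gamma>) t = tangent_map A B f (velocity A \<gamma> t)"
proof -
  define \<phi> where "\<phi> = (SOME \<phi>. \<phi> \<in> A \<and> \<gamma> t \<in> fst \<phi>)"
  have "\<exists>\<phi>. \<phi> \<in> A \<and> \<gamma> t \<in> fst \<phi>"
    using point by (auto simp: points_def)
  then have \<phi>: "\<phi> \<in> A" "\<gamma> t \<in> fst \<phi>"
    unfolding \<phi>_def by (metis (mono_tags, lifting) someI_ex)+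
  have "vector_derivative (snd \<psi> \<circ> (f \<circ> \<gamma>)) (at t) =
      frechet_derivative (snd \<psi> \<circ> f \<circ> chart_inv \<phi>) (at (snd \<phi> (\<gamma> t)))
        (vector_derivative (snd \<phi> \<circ> \<gamma>) (at t))"
    if \<psi>: "\<psi> \<in> B" "f (\<gamma> t) \<in> fst \<psi>" for \<psi>
  proof -
    obtain U where U: "open U" "t \<in> U" "\<gamma> ` U \<subseteq> fst \<phi>"
      using near[OF \<phi>] by blast
    have "vector_derivative (snd \<psi> \<circ> (f \<circ> \<gamma>)) (at t) =
        vector_derivative ((snd \<psi> \<circ> f \<circ> chart_inv \<phi>) \<circ> (snd \<phi> \<circ> \<gamma>)) (at t)"
      using U(3) chart_inv_left[OF inj[OF \<phi>(1)]]
      by (intro vector_derivative_cong_open[OF U(1,2)]) (auto simp: image_subset_iff)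
    also have "\<dots> = frechet_derivative (snd \<psi> \<circ> f \<circ> chart_inv \<phi>) (at (snd \<phi> (\<gamma> t)))
        (vector_derivative (snd \<phi> \<circ> \<gamma>) (at t))"
      using vector_derivative_compose[OF curve[OF \<phi>], of "snd \<psi> \<circ> f \<circ> chart_inv \<phi>"]
        map[OF \<phi>(1) \<psi>(1) \<phi>(2) \<psi>(2)]
      by simp
    finally show ?thesis .
  qed
  then show ?thesis
    using \<phi> unfolding velocity_def tangent_map_def Let_def fst_conv \<phi>_def[symmetric]
    by (auto simp: fun_eq_iff)
qed

lemma tangent_vectors_iff:
  "v \<in> tangent_vectors A \<longleftrightarrow> fst v \<in> points A \<and>
     (\<forall>\<phi>\<in>A. \<forall>\<psi>\<in>A. fst v \<in> fst \<phi> \<and> fst v \<in> fst \<psi> \<longrightarrow>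
        snd v \<psi> = frechet_derivative (transition \<phi> \<psi>) (at (snd \<phi> (fst v))) (snd v \<phi>)) \<and>
     (\<forall>\<phi>. \<not> (\<phi> \<in> A \<and> fst v \<in> fst \<phi>) \<longrightarrow> snd v \<phi> = 0)"
  by (simp only: tangent_vectors_def case_prod_beta mem_Collect_eq)

lemma tangent_vector_eq_0:
  assumes "v \<in> tangent_vectors A" "\<not> (\<phi> \<in> A \<and> fst v \<in> fst \<phi>)"
  shows "snd v \<phi> = 0"
  using assms(1)[unfolded tangent_vectors_iff] assms(2) by blast

lemma mem_tangent_chart [simp]:
  "v \<in> fst (tangent_chart A \<phi>) \<longleftrightarrow> v \<in> tangent_vectors A \<and> fst v \<in> fst \<phi>"
  by (simp add: tangent_chart_def)

lemma tangent_chart_apply [simp]: "snd (tangent_chart A \<phi>) v = (snd \<phi> (fst v), snd v \<phi>)"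
  by (simp add: tangent_chart_def)

locale smooth_atlas =
  fixes A :: "('a, 'e::euclidean_space) atlas"
  assumes smooth_manifold: "smooth_manifold A"
begin

lemma chart_inj: "\<phi> \<in> A \<Longrightarrow> inj_on (snd \<phi>) (fst \<phi>)"
  and open_chart_image: "\<phi> \<in> A \<Longrightarrow> open (snd \<phi> ` fst \<phi>)"
  and open_overlap: "\<phi> \<in> A \<Longrightarrow> \<psi> \<in> A \<Longrightarrow> open (snd \<phi> ` (fst \<phi> \<inter> fst \<psi>))"
  and smooth_on_transition:
    "\<phi> \<in> A \<Longrightarrow> \<psi> \<in> A \<Longrightarrow> smooth_on (snd \<phi> ` (fst \<phi> \<inter> fst \<psi>)) (transition \<phi> \<psi>)"
  using smooth_manifold unfolding smooth_manifold_def by blast+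

lemma transition_chart: "\<phi> \<in> A \<Longrightarrow> p \<in> fst \<phi> \<Longrightarrow> transition \<phi> \<psi> (snd \<phi> p) = snd \<psi> p"
  by (simp add: transition_def chart_inv_left chart_inj)

lemma differentiable_transition:
  "\<phi> \<in> A \<Longrightarrow> \<psi> \<in> A \<Longrightarrow> p \<in> fst \<phi> \<Longrightarrow> p \<in> fst \<psi> \<Longrightarrow> transition \<phi> \<psi> differentiable (at (snd \<phi> p))"
  by (rule smooth_on_imp_differentiable[OF smooth_on_transition]) auto

text \<open>Differentials do not depend on the chart they are computed in. For \<open>h\<close> a coordinate map this is
  the cocycle identity for the derivatives of the transition maps.\<close>

lemma frechet_derivative_change_chart:
  assumes "\<phi> \<in> A" "\<xi> \<in> A" "p \<in> fst \<phi>" "p \<in> fst \<xi>"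
    and "h \<circ> chart_inv \<xi> differentiable (at (snd \<xi> p))"
  shows "frechet_derivative (h \<circ> chart_inv \<xi>) (at (snd \<xi> p))
        (frechet_derivative (transition \<phi> \<xi>) (at (snd \<phi> p)) y) =
      frechet_derivative (h \<circ> chart_inv \<phi>) (at (snd \<phi> p)) y"
proof -
  have "frechet_derivative (h \<circ> chart_inv \<phi>) (at (snd \<phi> p)) =
      frechet_derivative ((h \<circ> chart_inv \<xi>) \<circ> transition \<phi> \<xi>) (at (snd \<phi> p))"
    by (rule frechet_derivative_cong_open[OF open_overlap[OF assms(1,2)]])
      (use assms in \<open>auto simp: transition_chart chart_inv_left chart_inj\<close>)
  also have "\<dots> = frechet_derivative (h \<circ> chart_inv \<xi>) (at (snd \<xi> p)) \<circ>
      frechet_derivative (transition \<phi> \<xi>) (at (snd \<phi> p))"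
    using assms frechet_derivative_compose[OF differentiable_transition[OF assms(1-4)],
        of "h \<circ> chart_inv \<xi>"]
    by (simp add: transition_chart)
  finally show ?thesis by simp
qed

lemma frechet_derivative_transition_self:
  assumes "\<phi> \<in> A" "p \<in> fst \<phi>"
  shows "frechet_derivative (transition \<phi> \<phi>) (at (snd \<phi> p)) y = y"
proof -
  have "frechet_derivative (transition \<phi> \<phi>) (at (snd \<phi> p)) =
      frechet_derivative (\<lambda>x. x) (at (snd \<phi> p))"
    by (rule frechet_derivative_cong_open[OF open_chart_image[OF assms(1)]])
      (use assms in \<open>auto simp: transition_chart\<close>)
  then show ?thesis by simp
qed

lemma tangent_vector_transition:
  assumes "v \<in> tangent_vectors A" "\<phi> \<in> A" "\<psi> \<in> A" "fst v \<in> fst \<phi>" "fst v \<in> fst \<psi>"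
  shows "snd v \<psi> = frechet_derivative (transition \<phi> \<psi>) (at (snd \<phi> (fst v))) (snd v \<phi>)"
  using assms(1)[unfolded tangent_vectors_iff] assms(2-5) by blast

lemma tangent_vector_in_chart:
  assumes "v \<in> tangent_vectors A"
  obtains \<phi> where "\<phi> \<in> A" "fst v \<in> fst \<phi>"
  using assms[unfolded tangent_vectors_iff] unfolding points_def by blast

lemma tangent_vector_eqI:
  assumes "v \<in> tangent_vectors A" "w \<in> tangent_vectors A" "fst v = fst w"
    and "\<phi> \<in> A" "fst v \<in> fst \<phi>" "snd v \<phi> = snd w \<phi>"
  shows "v = w"
proof (rule prod_eqI)
  show "snd v = snd w"
  proof
    fix \<psi> show "snd v \<psi> = snd w \<psi>"
      using assms tangent_vector_transition[of _ \<phi> \<psi>] tangent_vector_eq_0[of _ A \<psi>]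
      by (cases "\<psi> \<in> A \<and> fst v \<in> fst \<psi>") simp_all
  qed
qed (rule assms(3))

text \<open>The coordinate vector in one chart can be prescribed freely: the cocycle identity makes its images
  under the transition derivatives a coherent family. This is why the induced charts of the tangent
  bundle are onto \<open>U \<times> \<real>\<^sup>n\<close>.\<close>

lemma ex_tangent_vector:
  assumes "\<phi> \<in> A" "p \<in> fst \<phi>"
  obtains v where "v \<in> tangent_vectors A" "fst v = p" "snd v \<phi> = y"
proof
  define d where "d = (\<lambda>\<psi>. if \<psi> \<in> A \<and> p \<in> fst \<psi>
    then frechet_derivative (transition \<phi> \<psi>) (at (snd \<phi> p)) y else 0)"
  have d: "d \<psi> = frechet_derivative (transition \<phi> \<psi>) (at (snd \<phi> p)) y"
    if "\<psi> \<in> A" "p \<in> fst \<psi>" for \<psi>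
    using that by (simp add: d_def)
  have d0: "d \<psi> = 0" if "\<not> (\<psi> \<in> A \<and> p \<in> fst \<psi>)" for \<psi>
    using that unfolding d_def by (rule if_not_P)
  have "d \<xi> = frechet_derivative (transition \<psi> \<xi>) (at (snd \<psi> p)) (d \<psi>)"
    if "\<psi> \<in> A" "\<xi> \<in> A" "p \<in> fst \<psi>" "p \<in> fst \<xi>" for \<psi> \<xi>
  proof -
    have "snd \<xi> \<circ> chart_inv \<psi> differentiable (at (snd \<psi> p))"
      using differentiable_transition[OF that] by (simp only: transition_def)
    from frechet_derivative_change_chart[OF assms(1) that(1) assms(2) that(3) this]
    show ?thesis
      by (simp only: d[OF that(1,3)] d[OF that(2,4)] flip: transition_def)
  qed
  moreover have "p \<in> points A"
    unfolding points_def using assms by blast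
  ultimately show "(p, d) \<in> tangent_vectors A"
    unfolding tangent_vectors_iff fst_conv snd_conv using d0 by blast
  show "fst (p, d) = p" "snd (p, d) \<phi> = y"
    using assms by (simp_all add: d frechet_derivative_transition_self)
qed

lemma nonzero_tangent_vector_iff:
  assumes "v \<in> tangent_vectors A" "\<phi> \<in> A" "fst v \<in> fst \<phi>"
  shows "v \<in> nonzero_tangent_vectors A \<longleftrightarrow> snd v \<phi> \<noteq> 0"
proof -
  have "snd v \<psi> = 0" if "snd v \<phi> = 0" for \<psi>
    using assms that tangent_vector_transition[of v \<phi> \<psi>] tangent_vector_eq_0[of v A \<psi>]
      linear_0[OF linear_frechet_derivative[OF differentiable_transition[of \<phi> \<psi> "fst v"]]]
    by (cases "\<psi> \<in> A \<and> fst v \<in> fst \<psi>") simp_all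
  then show ?thesis
    unfolding nonzero_tangent_vectors_def fun_eq_iff using assms(1) by blast
qed

lemma nonzero_tangent_vectors_subset: "nonzero_tangent_vectors A \<subseteq> tangent_vectors A"
  by (auto simp: nonzero_tangent_vectors_def)

lemma tangent_chart_inj:
  assumes "\<phi> \<in> A"
  shows "inj_on (snd (tangent_chart A \<phi>)) (fst (tangent_chart A \<phi>))"
proof (rule inj_onI)
  fix v w
  assume "v \<in> fst (tangent_chart A \<phi>)" "w \<in> fst (tangent_chart A \<phi>)"
    and "snd (tangent_chart A \<phi>) v = snd (tangent_chart A \<phi>) w"
  then show "v = w"
    using tangent_vector_eqI[OF _ _ _ assms, of v w] inj_onD[OF chart_inj[OF assms], of "fst v" "fst w"]
    by simp
qed

lemma tangent_chart_image:
  assumes "\<phi> \<in> A"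
  shows "snd (tangent_chart A \<phi>) ` fst (tangent_chart A \<phi>) = snd \<phi> ` fst \<phi> \<times> (UNIV :: 'e set)"
proof (intro equalityI subsetI)
  fix z :: "'e \<times> 'e" assume "z \<in> snd \<phi> ` fst \<phi> \<times> UNIV"
  then obtain p where p: "p \<in> fst \<phi>" "fst z = snd \<phi> p" by auto
  obtain v where "v \<in> tangent_vectors A" "fst v = p" "snd v \<phi> = snd z"
    using ex_tangent_vector[OF assms p(1)] by blast
  then show "z \<in> snd (tangent_chart A \<phi>) ` fst (tangent_chart A \<phi>)"
    using p by (intro image_eqI[of _ _ v]) (simp_all add: prod_eq_iff)
qed auto

lemma chart_inv_tangent_chart:
  assumes "\<phi> \<in> A" "v \<in> tangent_vectors A" "fst v \<in> fst \<phi>"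
  shows "chart_inv (tangent_chart A \<phi>) (snd \<phi> (fst v), snd v \<phi>) = v"
  using chart_inv_left[OF tangent_chart_inj[OF assms(1)], of v] assms by simp

lemma tangent_chart_coords:
  fixes y :: 'e
  assumes "\<phi> \<in> A" "x \<in> snd \<phi> ` fst \<phi>"
  defines "v \<equiv> chart_inv (tangent_chart A \<phi>) (x, y)"
  shows "v \<in> tangent_vectors A" "fst v \<in> fst \<phi>" "snd \<phi> (fst v) = x" "fst v = chart_inv \<phi> x"
    "snd v \<phi> = y"
proof -
  have z: "(x, y) \<in> snd (tangent_chart A \<phi>) ` fst (tangent_chart A \<phi>)"
    using assms(2) unfolding tangent_chart_image[OF assms(1)] by simp
  show *: "v \<in> tangent_vectors A" "fst v \<in> fst \<phi>"
    using chart_inv_mem[OF z] by (simp_all add: v_def)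
  show **: "snd \<phi> (fst v) = x" "snd v \<phi> = y"
    using chart_inv_right[OF z] by (simp_all add: v_def)
  show "fst v = chart_inv \<phi> x"
    using chart_inv_left[OF chart_inj[OF assms(1)] *(2)] ** by simp
qed

lemma points_tangent_atlas: "points (tangent_atlas A) = tangent_vectors A"
proof -
  have "v \<in> points (tangent_atlas A) \<longleftrightarrow> v \<in> tangent_vectors A" for v
    by (auto simp: points_def tangent_atlas_def elim: tangent_vector_in_chart)
  then show ?thesis by blast
qed

lemma tangent_scale_mem:
  assumes "v \<in> tangent_vectors A"
  shows "tangent_scale c v \<in> tangent_vectors A"
proof -
  have "c *\<^sub>R snd v \<psi> = frechet_derivative (transition \<phi> \<psi>) (at (snd \<phi> (fst v))) (c *\<^sub>R snd v \<phi>)"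
    if "\<phi> \<in> A" "\<psi> \<in> A" "fst v \<in> fst \<phi>" "fst v \<in> fst \<psi>" for \<phi> \<psi>
    by (simp only: tangent_vector_transition[OF assms that]
      linear_cmul[OF linear_frechet_derivative[OF differentiable_transition[OF that]]])
  moreover have "fst v \<in> points A"
    using assms by (simp add: tangent_vectors_iff)
  moreover have "c *\<^sub>R snd v \<phi> = 0" if "\<not> (\<phi> \<in> A \<and> fst v \<in> fst \<phi>)" for \<phi>
    using tangent_vector_eq_0[OF assms that] by simp
  ultimately show ?thesis
    unfolding tangent_vectors_iff tangent_scale_def fst_conv snd_conv by blast
qed

end

section \<open>Curves and tangent maps\<close>

lemma smooth_curve_iff:
  fixes A :: "('a, 'e::euclidean_space) atlas" and \<gamma> :: "real \<Rightarrow> 'a"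
  shows "smooth_map euclidean_atlas I A \<gamma> \<longleftrightarrow> \<gamma> ` I \<subseteq> points A \<and>
     (\<forall>\<phi>\<in>A. open {t \<in> I. \<gamma> t \<in> fst \<phi>} \<and> smooth_on {t \<in> I. \<gamma> t \<in> fst \<phi>} (snd \<phi> \<circ> \<gamma>))"
proof -
  have "chart_inv (UNIV, \<lambda>x. x) x = x" for x :: real
    using chart_inv_left[of "(UNIV, \<lambda>x. x)" x] by (simp add: inj_on_def)
  then have "h \<circ> chart_inv (UNIV, \<lambda>x. x) = h" for h :: "real \<Rightarrow> 'e"
    by (simp add: comp_def)
  then show ?thesis
    unfolding smooth_map_def euclidean_atlas_def points_def by simp
qed

lemma fst_velocity [simp]: "fst (velocity A \<gamma> t) = \<gamma> t"
  by (simp add: velocity_def)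

lemma snd_velocity: "\<phi> \<in> A \<Longrightarrow> \<gamma> t \<in> fst \<phi> \<Longrightarrow> snd (velocity A \<gamma> t) \<phi> = vector_derivative (snd \<phi> \<circ> \<gamma>) (at t)"
  by (simp add: velocity_def)

lemma velocity_cong_open:
  assumes "open I" "t \<in> I" "\<And>s. s \<in> I \<Longrightarrow> \<gamma> s = \<delta> s"
  shows "velocity A \<gamma> t = velocity A \<delta> t"
proof -
  have "vector_derivative (snd \<phi> \<circ> \<gamma>) (at t) = vector_derivative (snd \<phi> \<circ> \<delta>) (at t)" for \<phi> :: "('a, 'b) chart"
    by (rule vector_derivative_cong_open[OF assms(1,2)]) (simp add: assms(3))
  then show ?thesis
    unfolding velocity_def by (simp only: assms(3)[OF assms(2)])
qed

lemma smooth_map_chart: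
  assumes "smooth_map A (points A) B f" "\<phi> \<in> A" "\<psi> \<in> B"
  shows "open (snd \<phi> ` {p \<in> fst \<phi>. f p \<in> fst \<psi>})"
    and "smooth_on (snd \<phi> ` {p \<in> fst \<phi>. f p \<in> fst \<psi>}) (snd \<psi> \<circ> f \<circ> chart_inv \<phi>)"
proof -
  have "{p \<in> points A \<inter> fst \<phi>. f p \<in> fst \<psi>} = {p \<in> fst \<phi>. f p \<in> fst \<psi>}"
    using assms(2) by (auto simp: points_def)
  moreover note assms(1)[unfolded smooth_map_def, THEN conjunct2, THEN conjunct2,
      rule_format, OF assms(2,3)]
  ultimately show "open (snd \<phi> ` {p \<in> fst \<phi>. f p \<in> fst \<psi>})"
    "smooth_on (snd \<phi> ` {p \<in> fst \<phi>. f p \<in> fst \<psi>}) (snd \<psi> \<circ> f \<circ> chart_inv \<phi>)"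
    by simp_all
qed

lemma smooth_map_chart_differentiable:
  assumes "smooth_map A (points A) B f" "\<phi> \<in> A" "\<psi> \<in> B" "p \<in> fst \<phi>" "f p \<in> fst \<psi>"
  shows "snd \<psi> \<circ> f \<circ> chart_inv \<phi> differentiable (at (snd \<phi> p))"
  using smooth_on_imp_differentiable[OF smooth_map_chart(2)[OF assms(1-3)]] assms(4,5) by simp

context smooth_atlas
begin

lemma curve_near:
  fixes \<gamma> :: "real \<Rightarrow> 'a"
  assumes "smooth_map euclidean_atlas I A \<gamma>" "t \<in> I" "\<phi> \<in> A" "\<gamma> t \<in> fst \<phi>"
  shows "\<exists>U. open U \<and> t \<in> U \<and> U \<subseteq> I \<and> \<gamma> ` U \<subseteq> fst \<phi>"
  using assms unfolding smooth_curve_iff by (intro exI[of _ "{t \<in> I. \<gamma> t \<in> fst \<phi>}"]) auto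

lemma curve_differentiable:
  fixes \<gamma> :: "real \<Rightarrow> 'a"
  assumes "smooth_map euclidean_atlas I A \<gamma>" "t \<in> I" "\<phi> \<in> A" "\<gamma> t \<in> fst \<phi>"
  shows "snd \<phi> \<circ> \<gamma> differentiable (at t)"
  using assms unfolding smooth_curve_iff
  by (intro smooth_on_imp_differentiable[of "{t \<in> I. \<gamma> t \<in> fst \<phi>}"]) auto

lemma velocity_mem:
  assumes \<gamma>: "smooth_map euclidean_atlas I A \<gamma>" and t: "t \<in> I"
  shows "velocity A \<gamma> t \<in> tangent_vectors A"
proof -
  have "snd (velocity A \<gamma> t) \<psi> =
      frechet_derivative (transition \<phi> \<psi>) (at (snd \<phi> (\<gamma> t))) (snd (velocity A \<gamma> t) \<phi>)"
    if \<phi>\<psi>: "\<phi> \<in> A" "\<psi> \<in> A" "\<gamma> t \<in> fst \<phi>" "\<gamma> t \<in> fst \<psi>" for \<phi> \<psi>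
  proof -
    obtain U where U: "open U" "t \<in> U" "\<gamma> ` U \<subseteq> fst \<phi>"
      using curve_near[OF \<gamma> t \<phi>\<psi>(1,3)] by blast
    have "vector_derivative (snd \<psi> \<circ> \<gamma>) (at t) =
        vector_derivative (transition \<phi> \<psi> \<circ> (snd \<phi> \<circ> \<gamma>)) (at t)"
      using U(3) by (intro vector_derivative_cong_open[OF U(1,2)])
        (simp add: image_subset_iff transition_chart[OF \<phi>\<psi>(1)])
    also have "\<dots> = frechet_derivative (transition \<phi> \<psi>) (at (snd \<phi> (\<gamma> t)))
        (vector_derivative (snd \<phi> \<circ> \<gamma>) (at t))"
      using vector_derivative_compose[OF curve_differentiable[OF \<gamma> t \<phi>\<psi>(1,3)], of "transition \<phi> \<psi>"]
        differentiable_transition[OF \<phi>\<psi>] by simp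
    finally show ?thesis
      using snd_velocity[of \<phi> A \<gamma> t] snd_velocity[of \<psi> A \<gamma> t] \<phi>\<psi> by simp
  qed
  moreover have "snd (velocity A \<gamma> t) \<phi> = 0" if "\<not> (\<phi> \<in> A \<and> \<gamma> t \<in> fst \<phi>)" for \<phi>
    using that unfolding velocity_def snd_conv by (rule if_not_P)
  moreover have "\<gamma> t \<in> points A"
    using \<gamma> t unfolding smooth_curve_iff by blast
  ultimately show ?thesis
    unfolding tangent_vectors_iff fst_velocity by blast
qed

text \<open>Velocity curves are differentiable again, so that they have velocities in the second tangent
  bundle.\<close>

lemma smooth_on_curve_derivative:
  assumes "smooth_map euclidean_atlas I A \<gamma>" "\<phi> \<in> A"
  shows "smooth_on {t \<in> I. \<gamma> t \<in> fst \<phi>} (\<lambda>s. vector_derivative (snd \<phi> \<circ> \<gamma>) (at s))"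
proof (rule smooth_on_cong)
  have *: "open {t \<in> I. \<gamma> t \<in> fst \<phi>}" "smooth_on {t \<in> I. \<gamma> t \<in> fst \<phi>} (snd \<phi> \<circ> \<gamma>)"
    using assms unfolding smooth_curve_iff by blast+
  show "open {t \<in> I. \<gamma> t \<in> fst \<phi>}"
    by (rule *)
  show "smooth_on {t \<in> I. \<gamma> t \<in> fst \<phi>} (\<lambda>s. frechet_derivative (snd \<phi> \<circ> \<gamma>) (at s) 1)"
    by (rule smooth_on_frechet_derivative[OF *(2)])
  show "frechet_derivative (snd \<phi> \<circ> \<gamma>) (at s) 1 = vector_derivative (snd \<phi> \<circ> \<gamma>) (at s)"
    if "s \<in> {t \<in> I. \<gamma> t \<in> fst \<phi>}" for s
    using vector_derivative_eq_frechet_derivative[OF smooth_on_imp_differentiable[OF *(2) that]] by simp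
qed

lemma curve_derivative_differentiable:
  assumes "smooth_map euclidean_atlas I A \<gamma>" "t \<in> I" "\<phi> \<in> A" "\<gamma> t \<in> fst \<phi>"
  shows "(\<lambda>s. vector_derivative (snd \<phi> \<circ> \<gamma>) (at s)) differentiable (at t)"
  using smooth_on_imp_differentiable[OF smooth_on_curve_derivative[OF assms(1,3)]] assms(2,4) by simp

lemma velocity_curve_near:
  assumes "smooth_map euclidean_atlas I A \<gamma>" "t \<in> I" "\<phi> \<in> A" "\<gamma> t \<in> fst \<phi>"
  obtains U where "open U" "t \<in> U" "velocity A \<gamma> ` U \<subseteq> fst (tangent_chart A \<phi>)"
    "\<And>s. s \<in> U \<Longrightarrow> (snd \<phi> (\<gamma> s), vector_derivative (snd \<phi> \<circ> \<gamma>) (at s)) =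
      (snd (tangent_chart A \<phi>) \<circ> velocity A \<gamma>) s"
proof -
  obtain U where U: "open U" "t \<in> U" "U \<subseteq> I" "\<gamma> ` U \<subseteq> fst \<phi>"
    using curve_near[OF assms] by blast
  have *: "s \<in> I" "\<gamma> s \<in> fst \<phi>" if "s \<in> U" for s
    using that U(3,4) by auto
  show ?thesis
  proof
    show "velocity A \<gamma> ` U \<subseteq> fst (tangent_chart A \<phi>)"
      using * velocity_mem[OF assms(1)] by auto
    show "(snd \<phi> (\<gamma> s), vector_derivative (snd \<phi> \<circ> \<gamma>) (at s)) =
      (snd (tangent_chart A \<phi>) \<circ> velocity A \<gamma>) s" if "s \<in> U" for s
      using *[OF that] assms(3) by (simp add: snd_velocity)
  qed (fact U(1,2))+
qed

lemma velocity_curve_has_vector_derivative: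
  assumes "smooth_map euclidean_atlas I A \<gamma>" "t \<in> I" "\<phi> \<in> A" "\<gamma> t \<in> fst \<phi>"
  shows "(snd (tangent_chart A \<phi>) \<circ> velocity A \<gamma> has_vector_derivative
     (vector_derivative (snd \<phi> \<circ> \<gamma>) (at t),
      vector_derivative (\<lambda>s. vector_derivative (snd \<phi> \<circ> \<gamma>) (at s)) (at t))) (at t)"
proof -
  obtain U where U: "open U" "t \<in> U"
    "\<And>s. s \<in> U \<Longrightarrow> (snd \<phi> (\<gamma> s), vector_derivative (snd \<phi> \<circ> \<gamma>) (at s)) =
      (snd (tangent_chart A \<phi>) \<circ> velocity A \<gamma>) s"
    using velocity_curve_near[OF assms] by metis
  have "((\<lambda>s. ((snd \<phi> \<circ> \<gamma>) s, vector_derivative (snd \<phi> \<circ> \<gamma>) (at s))) has_vector_derivative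
     (vector_derivative (snd \<phi> \<circ> \<gamma>) (at t),
      vector_derivative (\<lambda>s. vector_derivative (snd \<phi> \<circ> \<gamma>) (at s)) (at t))) (at t)"
    by (rule has_vector_derivative_Pair[OF
          curve_differentiable[OF assms, unfolded vector_derivative_works]
          curve_derivative_differentiable[OF assms, unfolded vector_derivative_works]])
  then show ?thesis
    by (rule has_vector_derivative_transform_within_open[OF _ U(1,2)]) (simp only: U(3)[symmetric] comp_apply[of "snd \<phi>" \<gamma>])
qed

lemma velocity_velocity_chart:
  assumes "smooth_map euclidean_atlas I A \<gamma>" "t \<in> I" "\<phi> \<in> A" "\<gamma> t \<in> fst \<phi>"
  shows "snd (velocity (tangent_atlas A) (velocity A \<gamma>) t) (tangent_chart A \<phi>) =
    (vector_derivative (snd \<phi> \<circ> \<gamma>) (at t),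
     vector_derivative (\<lambda>s. vector_derivative (snd \<phi> \<circ> \<gamma>) (at s)) (at t))"
proof -
  have "tangent_chart A \<phi> \<in> tangent_atlas A" "velocity A \<gamma> t \<in> fst (tangent_chart A \<phi>)"
    using assms velocity_mem[OF assms(1,2)] by (simp_all add: tangent_atlas_def)
  then show ?thesis
    by (simp only: snd_velocity vector_derivative_at[OF velocity_curve_has_vector_derivative[OF assms]])
qed

text \<open>The smooth composite of chart representatives is available only near each parameter, where the curve
  stays in one chart; openness and smoothness are therefore checked locally.\<close>

lemma smooth_map_curve:
  fixes \<gamma> :: "real \<Rightarrow> 'a"
  assumes f: "smooth_map A (points A) B f" and \<gamma>: "smooth_map euclidean_atlas I A \<gamma>"
  shows "smooth_map euclidean_atlas I B (f \<circ> \<gamma>)"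
  unfolding smooth_curve_iff
proof (intro conjI ballI)
  have \<gamma>I: "\<gamma> ` I \<subseteq> points A"
    using \<gamma> by (simp add: smooth_curve_iff)
  then show "(f \<circ> \<gamma>) ` I \<subseteq> points B"
    using f by (auto simp: smooth_map_def)
  fix \<psi> assume \<psi>: "\<psi> \<in> B"
  let ?T = "{t \<in> I. (f \<circ> \<gamma>) t \<in> fst \<psi>}"
  have "\<exists>U. open U \<and> t \<in> U \<and> U \<subseteq> ?T \<and> smooth_on U (snd \<psi> \<circ> (f \<circ> \<gamma>))" if t: "t \<in> ?T" for t
  proof -
    obtain \<phi> where \<phi>: "\<phi> \<in> A" "\<gamma> t \<in> fst \<phi>"
      using t \<gamma>I by (auto simp: points_def)
    let ?T' = "{t \<in> I. \<gamma> t \<in> fst \<phi>}" and ?D = "snd \<phi> ` {p \<in> fst \<phi>. f p \<in> fst \<psi>}"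
    have T': "open ?T'" "smooth_on ?T' (snd \<phi> \<circ> \<gamma>)"
      using \<gamma> \<phi> unfolding smooth_curve_iff by blast+
    note D = smooth_map_chart[OF f \<phi>(1) \<psi>]
    define U where "U = ?T' \<inter> (snd \<phi> \<circ> \<gamma>) -` ?D"
    have U: "open U"
      unfolding U_def by (rule continuous_open_preimage[OF smooth_on_imp_continuous_on[OF T'(2)] T'(1) D(1)])
    have "smooth_on U ((snd \<psi> \<circ> f \<circ> chart_inv \<phi>) \<circ> (snd \<phi> \<circ> \<gamma>))"
      by (rule smooth_on_compose[OF U D(1) _ _ D(2)])
        (auto simp: U_def intro: smooth_on_subset[OF T'(2)])
    then have "smooth_on U (snd \<psi> \<circ> (f \<circ> \<gamma>))"
      by (rule smooth_on_cong[OF U]) (simp add: U_def chart_inv_left chart_inj \<phi>(1))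
    moreover have "t \<in> U"
      using t \<phi>(2) by (simp add: U_def)
    moreover have "U \<subseteq> ?T"
    proof
      fix s assume "s \<in> U"
      then obtain p where p: "s \<in> I" "\<gamma> s \<in> fst \<phi>" "snd \<phi> (\<gamma> s) = snd \<phi> p" "p \<in> fst \<phi>" "f p \<in> fst \<psi>"
        by (auto simp: U_def)
      with inj_onD[OF chart_inj[OF \<phi>(1)] p(3,2,4)] show "s \<in> ?T" by simp
    qed
    ultimately show ?thesis using U by blast
  qed
  then show "open ?T" "smooth_on ?T (snd \<psi> \<circ> (f \<circ> \<gamma>))"
    unfolding open_subopen[of ?T] by (blast, intro smooth_on_locally) blast
qed

text \<open>The differential is defined through an arbitrarily chosen chart; any other chart gives the same
  coordinates.\<close>

lemma tangent_map_chart: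
  assumes "smooth_map A (points A) B f" "v \<in> tangent_vectors A"
    and "\<phi> \<in> A" "fst v \<in> fst \<phi>" "\<psi> \<in> B" "f (fst v) \<in> fst \<psi>"
  shows "snd (tangent_map A B f v) \<psi> =
    frechet_derivative (snd \<psi> \<circ> f \<circ> chart_inv \<phi>) (at (snd \<phi> (fst v))) (snd v \<phi>)"
proof -
  define \<xi> where "\<xi> = (SOME \<phi>. \<phi> \<in> A \<and> fst v \<in> fst \<phi>)"
  have "\<xi> \<in> A \<and> fst v \<in> fst \<xi>"
    unfolding \<xi>_def by (rule someI[of _ \<phi>]) (use assms in blast)
  then have \<xi>: "\<xi> \<in> A" "fst v \<in> fst \<xi>" by blast+
  have "snd (tangent_map A B f v) \<psi> =
      frechet_derivative (snd \<psi> \<circ> f \<circ> chart_inv \<xi>) (at (snd \<xi> (fst v))) (snd v \<xi>)"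
    using assms(5,6) by (simp add: tangent_map_def \<xi>_def Let_def)
  also have "snd v \<xi> = frechet_derivative (transition \<phi> \<xi>) (at (snd \<phi> (fst v))) (snd v \<phi>)"
    by (rule tangent_vector_transition[OF assms(2,3) \<xi>(1) assms(4) \<xi>(2)])
  also have "frechet_derivative (snd \<psi> \<circ> f \<circ> chart_inv \<xi>) (at (snd \<xi> (fst v))) \<dots> =
      frechet_derivative (snd \<psi> \<circ> f \<circ> chart_inv \<phi>) (at (snd \<phi> (fst v))) (snd v \<phi>)"
    by (rule frechet_derivative_change_chart[OF assms(3) \<xi>(1) assms(4) \<xi>(2)
          smooth_map_chart_differentiable[OF assms(1) \<xi>(1) assms(5) \<xi>(2) assms(6)]])
  finally show ?thesis .
qed

lemma velocity_smooth_map: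
  assumes f: "smooth_map A (points A) B f" and \<gamma>: "smooth_map euclidean_atlas I A \<gamma>" and t: "t \<in> I"
  shows "velocity B (f \<circ> \<gamma>) t = tangent_map A B f (velocity A \<gamma> t)"
proof (rule velocity_compose[OF chart_inj])
  show "\<gamma> t \<in> points A"
    using \<gamma> t unfolding smooth_curve_iff by blast
  show "\<exists>U. open U \<and> t \<in> U \<and> \<gamma> ` U \<subseteq> fst \<phi>" if "\<phi> \<in> A" "\<gamma> t \<in> fst \<phi>" for \<phi>
    using curve_near[OF \<gamma> t that] by blast
  show "snd \<phi> \<circ> \<gamma> differentiable (at t)" if "\<phi> \<in> A" "\<gamma> t \<in> fst \<phi>" for \<phi>
    by (rule curve_differentiable[OF \<gamma> t that])
  show "snd \<psi> \<circ> f \<circ> chart_inv \<phi> differentiable (at (snd \<phi> (\<gamma> t)))"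
    if "\<phi> \<in> A" "\<psi> \<in> B" "\<gamma> t \<in> fst \<phi>" "f (\<gamma> t) \<in> fst \<psi>" for \<phi> \<psi>
    by (rule smooth_map_chart_differentiable[OF f that])
qed

text \<open>In induced coordinates \<open>f\<^sub>*\<close> is \<open>(x, y) \<mapsto> (F x, DF\<^sub>x y)\<close>. Writing
  \<open>DF\<^sub>x y = \<Sum>\<^sub>b (y \<bullet> b) DF\<^sub>x b\<close> reduces its differentiability to that of the partial derivatives
  of \<open>F\<close>.\<close>

lemma tangent_map_chart_differentiable:
  assumes f: "smooth_map A (points A) B f" and v: "v \<in> tangent_vectors A"
    and \<phi>: "\<phi> \<in> A" "fst v \<in> fst \<phi>" and \<psi>: "\<psi> \<in> B" "f (fst v) \<in> fst \<psi>"
  shows "snd (tangent_chart B \<psi>) \<circ> tangent_map A B f \<circ> chart_inv (tangent_chart A \<phi>)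
    differentiable (at (snd \<phi> (fst v), snd v \<phi>))"
proof -
  define F where "F = snd \<psi> \<circ> f \<circ> chart_inv \<phi>"
  define D where "D = snd \<phi> ` {p \<in> fst \<phi>. f p \<in> fst \<psi>}"
  have D: "open D" "smooth_on D F"
    unfolding D_def F_def by (rule smooth_map_chart[OF f \<phi>(1) \<psi>(1)])+
  have vD: "snd \<phi> (fst v) \<in> D"
    using \<phi> \<psi> by (simp add: D_def)
  have "(\<lambda>z. (F (fst z), \<Sum>b\<in>Basis. (snd z \<bullet> b) *\<^sub>R frechet_derivative F (at (fst z)) b))
      differentiable (at (snd \<phi> (fst v), snd v \<phi>))"
  proof (intro differentiable_Pair differentiable_sum finite_Basis ballI differentiable_scaleR)
    have "F \<circ> fst differentiable (at (snd \<phi> (fst v), snd v \<phi>))"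
      using smooth_on_imp_differentiable[OF D(2) vD]
      by (intro differentiable_chain_at[OF bounded_linear_imp_differentiable[OF bounded_linear_fst]]) simp
    then show "(\<lambda>z. F (fst z)) differentiable (at (snd \<phi> (fst v), snd v \<phi>))"
      by (simp add: comp_def)
    fix b :: 'e
    have "(\<lambda>x. frechet_derivative F (at x) b) \<circ> fst differentiable (at (snd \<phi> (fst v), snd v \<phi>))"
      using smooth_on_imp_differentiable[OF smooth_on_frechet_derivative[OF D(2)] vD]
      by (intro differentiable_chain_at[OF bounded_linear_imp_differentiable[OF bounded_linear_fst]]) simp
    then show "(\<lambda>z. frechet_derivative F (at (fst z)) b) differentiable (at (snd \<phi> (fst v), snd v \<phi>))"
      by (simp add: comp_def)
    show "(\<lambda>z. snd z \<bullet> b) differentiable (at (snd \<phi> (fst v), snd v \<phi>))"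
      by (intro bounded_linear_imp_differentiable bounded_linear_inner_left_comp bounded_linear_snd)
  qed
  then obtain L where L: "((\<lambda>z. (F (fst z), \<Sum>b\<in>Basis. (snd z \<bullet> b) *\<^sub>R
      frechet_derivative F (at (fst z)) b)) has_derivative L) (at (snd \<phi> (fst v), snd v \<phi>))"
    unfolding differentiable_def by blast
  have "(F (fst z), \<Sum>b\<in>Basis. (snd z \<bullet> b) *\<^sub>R frechet_derivative F (at (fst z)) b) =
      (snd (tangent_chart B \<psi>) \<circ> tangent_map A B f \<circ> chart_inv (tangent_chart A \<phi>)) z"
    if "z \<in> D \<times> UNIV" for z
  proof -
    define w where "w = chart_inv (tangent_chart A \<phi>) z"
    have z: "fst z \<in> snd \<phi> ` fst \<phi>"
      using that by (auto simp: D_def)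
    note w = tangent_chart_coords[OF \<phi>(1) z, of "snd z", simplified, folded w_def]
    have "f (fst w) \<in> fst \<psi>"
      using that by (auto simp: D_def w(4) chart_inv_left[OF chart_inj[OF \<phi>(1)]])
    from tangent_map_chart[OF f w(1) \<phi>(1) w(2) \<psi>(1) this]
    have "snd (tangent_map A B f w) \<psi> = frechet_derivative F (at (fst z)) (snd z)"
      by (simp only: w(3,5) F_def)
    also have "\<dots> = (\<Sum>b\<in>Basis. (snd z \<bullet> b) *\<^sub>R frechet_derivative F (at (fst z)) b)"
      by (rule linear_eq_sum_Basis[OF linear_frechet_derivative[OF
            smooth_on_imp_differentiable[OF D(2)]]]) (use that in auto)
    moreover have "fst (tangent_map A B f w) = f (fst w)"
      by (simp add: tangent_map_def Let_def)
    ultimately show ?thesis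
      by (simp add: w_def[symmetric] F_def w(4))
  qed
  with L have "(snd (tangent_chart B \<psi>) \<circ> tangent_map A B f \<circ> chart_inv (tangent_chart A \<phi>)
      has_derivative L) (at (snd \<phi> (fst v), snd v \<phi>))"
    using vD by (intro has_derivative_transform_within_open[OF L, of "D \<times> UNIV"] open_Times D(1)) auto
  then show ?thesis
    by (rule differentiableI)
qed

text \<open>The chain rule one level up: \<open>f\<^sub>*\<close> maps velocity curves to velocity curves, and \<open>f\<^sub>*\<^sub>*\<close> their
  velocities.\<close>

lemma velocity_velocity_smooth_map:
  assumes f: "smooth_map A (points A) B f" and \<gamma>: "smooth_map euclidean_atlas I A \<gamma>" and t: "t \<in> I"
  shows "velocity (tangent_atlas B) (tangent_map A B f \<circ> velocity A \<gamma>) t =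
    tangent_map (tangent_atlas A) (tangent_atlas B) (tangent_map A B f)
      (velocity (tangent_atlas A) (velocity A \<gamma>) t)"
proof (rule velocity_compose)
  show "inj_on (snd \<Phi>) (fst \<Phi>)" if "\<Phi> \<in> tangent_atlas A" for \<Phi>
    using that tangent_chart_inj by (auto simp: tangent_atlas_def)
  show "velocity A \<gamma> t \<in> points (tangent_atlas A)"
    by (simp add: points_tangent_atlas velocity_mem[OF \<gamma> t])
  fix \<Phi> assume \<Phi>: "\<Phi> \<in> tangent_atlas A" "velocity A \<gamma> t \<in> fst \<Phi>"
  then obtain \<phi> where \<phi>: "\<Phi> = tangent_chart A \<phi>" "\<phi> \<in> A" "\<gamma> t \<in> fst \<phi>"
    by (auto simp: tangent_atlas_def)
  show "\<exists>U. open U \<and> t \<in> U \<and> velocity A \<gamma> ` U \<subseteq> fst \<Phi>"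
    using velocity_curve_near[OF \<gamma> t \<phi>(2,3)] unfolding \<phi>(1) by metis
  show "snd \<Phi> \<circ> velocity A \<gamma> differentiable (at t)"
    using velocity_curve_has_vector_derivative[OF \<gamma> t \<phi>(2,3)] unfolding \<phi>(1)
    by (rule differentiableI_vector)
  fix \<Psi> assume \<Psi>: "\<Psi> \<in> tangent_atlas B" "tangent_map A B f (velocity A \<gamma> t) \<in> fst \<Psi>"
  then obtain \<psi> where \<psi>: "\<Psi> = tangent_chart B \<psi>" "\<psi> \<in> B" "f (\<gamma> t) \<in> fst \<psi>"
    by (auto simp: tangent_atlas_def tangent_map_def Let_def)
  show "snd \<Psi> \<circ> tangent_map A B f \<circ> chart_inv \<Phi> differentiable (at (snd \<Phi> (velocity A \<gamma> t)))"
    using tangent_map_chart_differentiable[OF f velocity_mem[OF \<gamma> t] \<phi>(2) _ \<psi>(2)] \<phi>(3) \<psi>(3)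
    by (simp add: \<phi>(1) \<psi>(1))
qed

end

section \<open>Geodesics of a spray\<close>

lemma velocity_reparam:
  fixes \<gamma> :: "real \<Rightarrow> 'a"
  assumes "\<And>\<phi>. \<phi> \<in> A \<Longrightarrow> \<gamma> (\<theta> t) \<in> fst \<phi> \<Longrightarrow> snd \<phi> \<circ> \<gamma> differentiable (at (\<theta> t))"
    and "(\<theta> has_real_derivative a) (at t)"
  shows "velocity A (\<gamma> \<circ> \<theta>) t = tangent_scale a (velocity A \<gamma> (\<theta> t))"
proof -
  have "vector_derivative (snd \<phi> \<circ> (\<gamma> \<circ> \<theta>)) (at t) = a *\<^sub>R vector_derivative (snd \<phi> \<circ> \<gamma>) (at (\<theta> t))"
    if "\<phi> \<in> A" "\<gamma> (\<theta> t) \<in> fst \<phi>" for \<phi>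
  proof -
    have "\<theta> differentiable (at t)" "vector_derivative \<theta> (at t) = a"
      using assms(2) vector_derivative_at[of \<theta> a t] differentiableI_vector[of \<theta> a "at t"]
      by (simp_all add: has_real_derivative_iff_has_vector_derivative)
    with vector_derivative_chain_at[of \<theta> t "snd \<phi> \<circ> \<gamma>"] assms(1)[OF that] show ?thesis
      by (simp only: comp_assoc)
  qed
  then show ?thesis
    by (intro prod_eqI ext) (simp_all add: velocity_def tangent_scale_def)
qed

lemma spray_fst: "spray A S \<Longrightarrow> v \<in> nonzero_tangent_vectors A \<Longrightarrow> fst (S v) = v"
  by (simp add: spray_def smooth_vector_field_def)

lemma spray_mem:
  assumes "spray A S" "v \<in> nonzero_tangent_vectors A"
  shows "S v \<in> tangent_vectors (tangent_atlas A)"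
proof -
  have "S v \<in> points (tangent_atlas (tangent_atlas A))"
    using assms unfolding spray_def smooth_vector_field_def smooth_map_def by blast
  then show ?thesis
    by (auto simp: points_def tangent_atlas_def[of "tangent_atlas A"])
qed

text \<open>The condition \<open>JS = C\<close> says that the \<open>\<partial>/\<partial>x\<close>-part of \<open>S\<close> is \<open>y\<close>.\<close>

lemma spray_chart:
  assumes "spray A S" "v \<in> nonzero_tangent_vectors A" "v \<in> tangent_vectors A" "\<phi> \<in> A" "fst v \<in> fst \<phi>"
  shows "snd (S v) (tangent_chart A \<phi>) = (snd v \<phi>, spray_coeff A S \<phi> v)"
proof -
  have "vertical_endomorphism (S v) = liouville_field A v"
    using assms unfolding spray_def by blast
  then have "snd (vertical_endomorphism (S v)) (tangent_chart A \<phi>) =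
      snd (liouville_field A v) (tangent_chart A \<phi>)"
    by simp
  then have "fst (snd (S v) (tangent_chart A \<phi>)) = snd v \<phi>"
    using assms(3-5) by (simp add: vertical_endomorphism_def liouville_field_def tangent_atlas_def)
  then show ?thesis
    by (simp add: spray_coeff_def prod_eq_iff)
qed

lemma is_interval_affine_preimage:
  assumes "is_interval I" "a > 0"
  shows "is_interval {t::real. a * t + b \<in> I}"
  unfolding is_interval_1
proof (intro ballI allI impI)
  fix r s t assume *: "r \<in> {t. a * t + b \<in> I}" "s \<in> {t. a * t + b \<in> I}" "r \<le> t \<and> t \<le> s"
  then have "a * r + b \<le> a * t + b" "a * t + b \<le> a * s + b"
    using assms(2) by simp_all
  then show "t \<in> {t. a * t + b \<in> I}"
    using assms(1) * unfolding is_interval_1 by blast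
qed

lemma open_affine_preimage: "open I \<Longrightarrow> open {t::real. a * t + b \<in> I}"
  using continuous_open_vimage[of I "\<lambda>t. a * t + b"]
  by (simp add: vimage_def continuous_intros)

context smooth_atlas
begin

lemma regular_curveD:
  assumes "regular_curve A (I, \<gamma>)"
  shows "open I" "is_interval I" "I \<noteq> {}" "smooth_map euclidean_atlas I A \<gamma>"
    "\<And>t. t \<in> I \<Longrightarrow> velocity A \<gamma> t \<in> nonzero_tangent_vectors A"
  using assms by (simp_all add: regular_curve_def)

lemma velocity_curve_reparam:
  assumes "smooth_map euclidean_atlas I A \<gamma>" "\<theta> t \<in> I" "(\<theta> has_real_derivative a) (at t)"
  shows "velocity A (\<gamma> \<circ> \<theta>) t = tangent_scale a (velocity A \<gamma> (\<theta> t))"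
  by (rule velocity_reparam[OF curve_differentiable[OF assms(1,2)] assms(3)])

lemma nonzero_tangent_scale_iff:
  assumes "c \<noteq> 0" "v \<in> tangent_vectors A"
  shows "tangent_scale c v \<in> nonzero_tangent_vectors A \<longleftrightarrow> v \<in> nonzero_tangent_vectors A"
  using assms tangent_scale_mem[OF assms(2), of c]
  by (simp add: nonzero_tangent_vectors_def tangent_scale_def fun_eq_iff)

lemma regular_curve_affine:
  assumes \<gamma>: "regular_curve A (I, \<gamma>)" and a: "a > 0"
  shows "regular_curve A ({t. a * t + b \<in> I}, \<gamma> \<circ> (\<lambda>t. a * t + b))"
proof -
  note \<gamma>' = regular_curveD[OF \<gamma>]
  let ?\<theta> = "\<lambda>t. a * t + b" and ?J = "{t. a * t + b \<in> I}"
  have J: "open ?J"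
    by (rule open_affine_preimage[OF \<gamma>'(1)])
  have smooth: "smooth_map euclidean_atlas ?J A (\<gamma> \<circ> ?\<theta>)"
    unfolding smooth_curve_iff
  proof (intro conjI ballI)
    show "(\<gamma> \<circ> ?\<theta>) ` ?J \<subseteq> points A"
      using \<gamma>'(4) by (auto simp: smooth_curve_iff)
    fix \<phi> assume "\<phi> \<in> A"
    then have *: "open {t \<in> I. \<gamma> t \<in> fst \<phi>}" "smooth_on {t \<in> I. \<gamma> t \<in> fst \<phi>} (snd \<phi> \<circ> \<gamma>)"
      using \<gamma>'(4) unfolding smooth_curve_iff by blast+
    have eq: "{t \<in> ?J. (\<gamma> \<circ> ?\<theta>) t \<in> fst \<phi>} = {t. ?\<theta> t \<in> {t \<in> I. \<gamma> t \<in> fst \<phi>}}"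
      by auto
    show o: "open {t \<in> ?J. (\<gamma> \<circ> ?\<theta>) t \<in> fst \<phi>}"
      unfolding eq by (rule open_affine_preimage[OF *(1)])
    show "smooth_on {t \<in> ?J. (\<gamma> \<circ> ?\<theta>) t \<in> fst \<phi>} (snd \<phi> \<circ> (\<gamma> \<circ> ?\<theta>))"
      unfolding comp_assoc[symmetric]
      by (rule smooth_on_compose[OF _ *(1) _ smooth_on_affine *(2)]) (use o in auto)
  qed
  have D: "(?\<theta> has_real_derivative a) (at t)" for t
    by (auto intro!: derivative_eq_intros)
  have "velocity A (\<gamma> \<circ> ?\<theta>) t \<in> nonzero_tangent_vectors A" if "?\<theta> t \<in> I" for t
  proof -
    have "velocity A \<gamma> (?\<theta> t) \<in> nonzero_tangent_vectors A" "velocity A \<gamma> (?\<theta> t) \<in> tangent_vectors A"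
      using \<gamma>'(5)[OF that] velocity_mem[OF \<gamma>'(4) that] by simp_all
    then show ?thesis
      using velocity_curve_reparam[where \<theta>="?\<theta>", OF \<gamma>'(4) that D]
        nonzero_tangent_scale_iff[of a] a by simp
  qed
  moreover obtain s where "s \<in> I" using \<gamma>'(3) by blast
  then have "(s - b) / a \<in> ?J" using a by simp
  then have "?J \<noteq> {}" by blast
  ultimately show ?thesis
    using J smooth is_interval_affine_preimage[OF \<gamma>'(2) a] by (simp add: regular_curve_def)
qed

lemma regular_curve_cong:
  assumes \<gamma>: "regular_curve A (I, \<gamma>)" and eq: "\<And>t. t \<in> I \<Longrightarrow> \<gamma> t = \<delta> t"
  shows "regular_curve A (I, \<delta>)"
proof -
  note \<gamma>' = regular_curveD[OF \<gamma>]
  have "smooth_map euclidean_atlas I A \<delta>"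
    unfolding smooth_curve_iff
  proof (intro conjI ballI)
    show "\<delta> ` I \<subseteq> points A"
      using \<gamma>'(4) eq by (auto simp: smooth_curve_iff)
    fix \<phi> assume "\<phi> \<in> A"
    then have *: "open {t \<in> I. \<gamma> t \<in> fst \<phi>}" "smooth_on {t \<in> I. \<gamma> t \<in> fst \<phi>} (snd \<phi> \<circ> \<gamma>)"
      using \<gamma>'(4) unfolding smooth_curve_iff by blast+
    have e: "{t \<in> I. \<delta> t \<in> fst \<phi>} = {t \<in> I. \<gamma> t \<in> fst \<phi>}"
      using eq by auto
    show "open {t \<in> I. \<delta> t \<in> fst \<phi>}"
      unfolding e by (rule *)
    show "smooth_on {t \<in> I. \<delta> t \<in> fst \<phi>} (snd \<phi> \<circ> \<delta>)"
      unfolding e by (rule smooth_on_cong[OF *]) (simp add: eq)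
  qed
  moreover have "velocity A \<delta> t \<in> nonzero_tangent_vectors A" if "t \<in> I" for t
    using \<gamma>'(5)[OF that] velocity_cong_open[where A=A and \<gamma>=\<gamma> and \<delta>=\<delta>, OF \<gamma>'(1) that eq] by simp
  ultimately show ?thesis
    using \<gamma>'(1-3) by (simp add: regular_curve_def)
qed

lemma nonzero_tangent_chart_coords:
  assumes "\<phi> \<in> A" "z \<in> snd \<phi> ` fst \<phi> \<times> (- {0})"
  defines "v \<equiv> chart_inv (tangent_chart A \<phi>) z"
  shows "v \<in> nonzero_tangent_vectors A" "v \<in> tangent_vectors A" "fst v \<in> fst \<phi>"
    "snd \<phi> (fst v) = fst z" "snd v \<phi> = snd z"
proof -
  have z: "fst z \<in> snd \<phi> ` fst \<phi>" "snd z \<noteq> 0" using assms(2) by auto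
  note v = tangent_chart_coords[OF assms(1) z(1), of "snd z", unfolded prod.collapse, folded v_def]
  show "v \<in> tangent_vectors A" "fst v \<in> fst \<phi>" "snd \<phi> (fst v) = fst z" "snd v \<phi> = snd z"
    by (fact v)+
  show "v \<in> nonzero_tangent_vectors A"
    using nonzero_tangent_vector_iff[OF v(1) assms(1) v(2)] v(5) z(2) by simp
qed

text \<open>In induced coordinates \<open>C = (0, y)\<close> and \<open>S = (y, f)\<close>, so the bracket \<open>[C, S]\<close> is
  \<open>(y, D\<^sub>y f(y) - f)\<close>. Hence \<open>[C, S] = S\<close> is Euler's identity \<open>D\<^sub>y f(y) = 2 f\<close>.\<close>

lemma spray_coeff_coords:
  assumes "spray A S" "\<phi> \<in> A"
  defines "f \<equiv> \<lambda>z. spray_coeff A S \<phi> (chart_inv (tangent_chart A \<phi>) z)"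
  assumes x: "x \<in> snd \<phi> ` fst \<phi>" and y: "y \<noteq> 0"
  shows "f differentiable (at (x, y))"
    and "frechet_derivative f (at (x, y)) (0, y) = 2 *\<^sub>R f (x, y)"
proof -
  let ?\<Phi> = "tangent_chart A \<phi>" and ?Z = "snd \<phi> ` fst \<phi> \<times> (- {0 :: 'e})"
  \<comment> \<open>\<open>S\<close> takes values in the second tangent bundle, with coordinates \<open>((x, y), (y, f))\<close>\<close>
  let ?\<Psi> = "tangent_chart (tangent_atlas A) ?\<Phi>"
  have \<Phi>: "?\<Phi> \<in> tangent_atlas A"
    using assms(2) by (simp add: tangent_atlas_def)
  have \<Psi>: "?\<Psi> \<in> tangent_atlas (tangent_atlas A)"
    using \<Phi> by (simp add: tangent_atlas_def[of "tangent_atlas A"])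
  have openZ: "open ?Z"
    by (intro open_Times open_chart_image[OF assms(2)] open_Compl closed_singleton)
  note coords = nonzero_tangent_chart_coords[OF assms(2)]
  have S: "smooth_map (tangent_atlas A) (nonzero_tangent_vectors A) (tangent_atlas (tangent_atlas A)) S"
    using assms(1) by (simp add: spray_def smooth_vector_field_def)
  have "smooth_on (snd ?\<Phi> ` {v \<in> nonzero_tangent_vectors A \<inter> fst ?\<Phi>. S v \<in> fst ?\<Psi>})
      (snd ?\<Psi> \<circ> S \<circ> chart_inv ?\<Phi>)"
    using S \<Phi> \<Psi> unfolding smooth_map_def by blast
  moreover have "?Z \<subseteq> snd ?\<Phi> ` {v \<in> nonzero_tangent_vectors A \<inter> fst ?\<Phi>. S v \<in> fst ?\<Psi>}"
  proof
    fix z assume z: "z \<in> ?Z"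
    note c = coords[OF z]
    show "z \<in> snd ?\<Phi> ` {v \<in> nonzero_tangent_vectors A \<inter> fst ?\<Phi>. S v \<in> fst ?\<Psi>}"
    proof (rule image_eqI)
      show "z = snd ?\<Phi> (chart_inv ?\<Phi> z)"
        using c by (simp add: prod_eq_iff)
      show "chart_inv ?\<Phi> z \<in> {v \<in> nonzero_tangent_vectors A \<inter> fst ?\<Phi>. S v \<in> fst ?\<Psi>}"
        using c spray_mem[OF assms(1) c(1)] spray_fst[OF assms(1) c(1)] by simp
    qed
  qed
  ultimately have smooth: "smooth_on ?Z (snd ?\<Psi> \<circ> S \<circ> chart_inv ?\<Phi>)"
    by (rule smooth_on_subset)
  have S_coords: "(snd ?\<Psi> \<circ> S \<circ> chart_inv ?\<Phi>) z = (z, snd z, f z)" if "z \<in> ?Z" for z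
    using coords[OF that] spray_chart[OF assms(1) coords(1,2)[OF that] assms(2) coords(3)[OF that]]
      spray_fst[OF assms(1) coords(1)[OF that]]
    by (simp add: f_def prod_eq_iff)
  have z: "(x, y) \<in> ?Z"
    using x y by simp
  have "(snd \<circ> snd) \<circ> (snd ?\<Psi> \<circ> S \<circ> chart_inv ?\<Phi>) differentiable (at (x, y))"
    by (intro differentiable_chain_at smooth_on_imp_differentiable[OF smooth z]
        bounded_linear_imp_differentiable bounded_linear_compose[OF bounded_linear_snd bounded_linear_snd, folded comp_def])
  then obtain D where D: "((snd \<circ> snd) \<circ> (snd ?\<Psi> \<circ> S \<circ> chart_inv ?\<Phi>) has_derivative D) (at (x, y))"
    unfolding differentiable_def by blast
  have fD: "(f has_derivative D) (at (x, y))"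
    by (rule has_derivative_transform_within_open[OF D openZ z]) (use S_coords in simp)
  then show "f differentiable (at (x, y))"
    by (rule differentiableI)
  let ?v = "chart_inv ?\<Phi> (x, y)"
  note v = coords[OF z]
  have vfS: "vf_coords ?\<Phi> S z = (snd z, f z)" if "z \<in> ?Z" for z
    using spray_chart[OF assms(1) coords(1,2)[OF that] assms(2) coords(3)[OF that]] coords(5)[OF that]
    by (simp add: vf_coords_def f_def)
  have vfC: "vf_coords ?\<Phi> (liouville_field A) z = (0, snd z)" if "z \<in> ?Z" for z
    using coords[OF that] \<Phi> by (simp add: vf_coords_def liouville_field_def)
  have dS: "frechet_derivative (vf_coords ?\<Phi> S) (at (x, y)) (0, y) = (y, D (0, y))"
  proof -
    have "((\<lambda>z. (snd z, f z)) has_derivative (\<lambda>h. (snd h, D h))) (at (x, y))"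
      by (intro has_derivative_Pair fD has_derivative_snd has_derivative_ident)
    then have "(vf_coords ?\<Phi> S has_derivative (\<lambda>h. (snd h, D h))) (at (x, y))"
      by (rule has_derivative_transform_within_open[OF _ openZ z]) (simp add: vfS)
    from frechet_derivative_at[OF this, symmetric] show ?thesis by simp
  qed
  have dC: "frechet_derivative (vf_coords ?\<Phi> (liouville_field A)) (at (x, y)) (y, f (x, y)) = (0, f (x, y))"
  proof -
    have "((\<lambda>z. (0 :: 'e, snd z :: 'e)) has_derivative (\<lambda>h. (0, snd h))) (at (x, y))"
      by (intro has_derivative_Pair has_derivative_const has_derivative_snd has_derivative_ident)
    then have "(vf_coords ?\<Phi> (liouville_field A) has_derivative (\<lambda>h. (0, snd h))) (at (x, y))"
      by (rule has_derivative_transform_within_open[OF _ openZ z]) (simp add: vfC)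
    from frechet_derivative_at[OF this, symmetric] show ?thesis by simp
  qed
  have "snd (lie_bracket (tangent_atlas A) (liouville_field A) S ?v) ?\<Phi> = snd (S ?v) ?\<Phi>"
    using assms(1) v(1) by (simp add: spray_def)
  \<comment> \<open>\<open>DS(C) - DC(S) = S\<close>, read off in the chart\<close>
  then have "(y, D (0, y)) - (0, f (x, y)) = (y, f (x, y))"
    using v \<Phi> spray_chart[OF assms(1) v(1,2) assms(2) v(3)] vfS[OF z] vfC[OF z] dS dC
    by (simp add: lie_bracket_def Let_def f_def)
  then have "D (0, y) = f (x, y) + f (x, y)"
    by (simp add: algebra_simps)
  then show "frechet_derivative f (at (x, y)) (0, y) = 2 *\<^sub>R f (x, y)"
    by (simp add: frechet_derivative_at[OF fD, symmetric] scaleR_2)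
qed

text \<open>Euler's identity \<open>t h'(t) = 2 h(t)\<close> integrates to quadratic growth because \<open>h(t) / t\<^sup>2\<close> has
  derivative 0.\<close>

lemma quadratic_if_euler_identity:
  fixes h :: "real \<Rightarrow> 'b::real_normed_vector"
  assumes "\<And>t. t > 0 \<Longrightarrow> \<exists>w. (h has_vector_derivative w) (at t) \<and> t *\<^sub>R w = 2 *\<^sub>R h t" and "c > 0"
  shows "h c = c\<^sup>2 *\<^sub>R h 1"
proof -
  define k where "k t = inverse (t\<^sup>2) *\<^sub>R h t" for t
  have "(k has_vector_derivative 0) (at t within {0<..})" if "t \<in> {0<..}" for t
  proof -
    have t: "t > 0" using that by simp
    obtain w where w: "(h has_vector_derivative w) (at t)" "t *\<^sub>R w = 2 *\<^sub>R h t"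
      using assms(1)[OF t] by blast
    have "w = (2 / t) *\<^sub>R h t"
      using arg_cong[OF w(2), of "\<lambda>u. inverse t *\<^sub>R u"] t by (simp add: divide_inverse mult.commute)
    moreover have "((\<lambda>t. inverse (t\<^sup>2)) has_real_derivative (- 2 / t ^ 3)) (at t)"
      using t by (auto intro!: derivative_eq_intros simp: field_simps power2_eq_square power3_eq_cube)
    from has_vector_derivative_scaleR[OF this w(1)]
    have "(k has_vector_derivative (inverse (t\<^sup>2) *\<^sub>R w + (- 2 / t ^ 3) *\<^sub>R h t)) (at t)"
      unfolding k_def .
    moreover have "inverse (t\<^sup>2) * (2 / t) + (- 2 / t ^ 3) = 0"
      using t by (simp add: field_simps power2_eq_square power3_eq_cube)
    ultimately have "(k has_vector_derivative 0) (at t)"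
      by (simp flip: scaleR_add_left)
    then show ?thesis by (rule has_vector_derivative_at_within)
  qed
  then obtain d where "\<And>t. t \<in> {0<..} \<Longrightarrow> k t = d"
    using has_vector_derivative_zero_constant[of "{0<..}" k] by auto
  then have "k c = k 1" using assms(2) by simp
  then have "c\<^sup>2 *\<^sub>R k c = c\<^sup>2 *\<^sub>R h 1" by (simp add: k_def)
  then show ?thesis using assms(2) by (simp add: k_def)
qed

lemma spray_coeff_homogeneous:
  assumes S: "spray A S" and v: "v \<in> nonzero_tangent_vectors A" and \<phi>: "\<phi> \<in> A" "fst v \<in> fst \<phi>"
    and c: "c > 0"
  shows "spray_coeff A S \<phi> (tangent_scale c v) = c\<^sup>2 *\<^sub>R spray_coeff A S \<phi> v"
proof -
  let ?x = "snd \<phi> (fst v)" and ?y = "snd v \<phi>"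
  define f where "f z = spray_coeff A S \<phi> (chart_inv (tangent_chart A \<phi>) z)" for z
  have v': "v \<in> tangent_vectors A"
    using v nonzero_tangent_vectors_subset by blast
  have y: "?y \<noteq> 0"
    using nonzero_tangent_vector_iff[OF v' \<phi>] v by simp
  have scale: "chart_inv (tangent_chart A \<phi>) (?x, t *\<^sub>R ?y) = tangent_scale t v" for t
    using chart_inv_tangent_chart[OF \<phi>(1) tangent_scale_mem[OF v', of t]] \<phi>(2)
    by (simp add: tangent_scale_def)
  define h where "h t = f (?x, t *\<^sub>R ?y)" for t
  have "\<exists>w. (h has_vector_derivative w) (at t) \<and> t *\<^sub>R w = 2 *\<^sub>R h t" if t: "t > 0" for t
  proof -
    have "?x \<in> snd \<phi> ` fst \<phi>" "t *\<^sub>R ?y \<noteq> 0" using \<phi>(2) t y by simp_all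
    note f = spray_coeff_coords[OF S \<phi>(1) this, folded f_def]
    define w where "w = frechet_derivative f (at (?x, t *\<^sub>R ?y)) (0, ?y)"
    have lin: "linear (frechet_derivative f (at (?x, t *\<^sub>R ?y)))"
      by (rule linear_frechet_derivative[OF f(1)])
    have "((\<lambda>t. (?x, t *\<^sub>R ?y)) has_vector_derivative (0, ?y)) (at t)"
      by (auto intro!: derivative_eq_intros has_vector_derivative_Pair)
    then have "(f \<circ> (\<lambda>t. (?x, t *\<^sub>R ?y)) has_vector_derivative w) (at t)"
      unfolding w_def
      by (rule vector_derivative_diff_chain_within)
        (rule has_derivative_at_withinI, use f(1) in \<open>simp add: frechet_derivative_works\<close>)
    moreover have "t *\<^sub>R w = frechet_derivative f (at (?x, t *\<^sub>R ?y)) (0, t *\<^sub>R ?y)"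
      using linear_cmul[OF lin, of t "(0, ?y)"] by (simp add: w_def)
    moreover have "h = f \<circ> (\<lambda>t. (?x, t *\<^sub>R ?y))"
      by (simp add: h_def fun_eq_iff)
    ultimately show ?thesis
      using f(2) by auto
  qed
  from quadratic_if_euler_identity[where h=h, OF this c] have "h c = c\<^sup>2 *\<^sub>R h 1" .
  then show ?thesis
    using scale[of c] scale[of 1] by (simp add: h_def f_def tangent_scale_def)
qed

text \<open>The chart-free form of the geodesic equation: the velocity curve is an integral curve of \<open>S\<close>. In
  this form, invariance of the family of geodesics is a matter of the chain rule.\<close>

lemma spray_geodesic_iff:
  assumes S: "spray A S"
  shows "(I, \<gamma>) \<in> spray_geodesics A S \<longleftrightarrow> regular_curve A (I, \<gamma>) \<and>
    (\<forall>t\<in>I. velocity (tangent_atlas A) (velocity A \<gamma>) t = S (velocity A \<gamma> t))"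
proof -
  have "(\<forall>\<phi>\<in>A. \<gamma> t \<in> fst \<phi> \<longrightarrow> ((\<lambda>s. vector_derivative (snd \<phi> \<circ> \<gamma>) (at s))
           has_vector_derivative spray_coeff A S \<phi> (velocity A \<gamma> t)) (at t)) \<longleftrightarrow>
      velocity (tangent_atlas A) (velocity A \<gamma>) t = S (velocity A \<gamma> t)" (is "?L \<longleftrightarrow> ?R")
    if \<gamma>: "regular_curve A (I, \<gamma>)" and t: "t \<in> I" for t
  proof -
    let ?v = "velocity A \<gamma> t"
    note sm = regular_curveD(4)[OF \<gamma>]
    have v: "?v \<in> nonzero_tangent_vectors A" "?v \<in> tangent_vectors A"
      by (rule regular_curveD(5)[OF \<gamma> t], rule velocity_mem[OF sm t])
    have *: "((\<lambda>s. vector_derivative (snd \<phi> \<circ> \<gamma>) (at s))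
           has_vector_derivative spray_coeff A S \<phi> ?v) (at t) \<longleftrightarrow>
        snd (velocity (tangent_atlas A) (velocity A \<gamma>) t) (tangent_chart A \<phi>) =
        snd (S ?v) (tangent_chart A \<phi>)" if \<phi>: "\<phi> \<in> A" "\<gamma> t \<in> fst \<phi>" for \<phi>
      using velocity_velocity_chart[OF sm t \<phi>] spray_chart[OF S v \<phi>(1)] \<phi>
        curve_derivative_differentiable[OF sm t \<phi>] snd_velocity[of \<phi> A \<gamma> t]
      by (auto simp: vector_derivative_works dest: vector_derivative_at)
    have "snd (velocity (tangent_atlas A) (velocity A \<gamma>) t) \<Phi> = snd (S ?v) \<Phi>"
      if "\<not> (\<Phi> \<in> tangent_atlas A \<and> ?v \<in> fst \<Phi>)" for \<Phi>
    proof -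
      have "snd (velocity (tangent_atlas A) (velocity A \<gamma>) t) \<Phi> = 0"
        using that unfolding velocity_def[of "tangent_atlas A"] snd_conv by (rule if_not_P)
      moreover have "snd (S ?v) \<Phi> = 0"
        using tangent_vector_eq_0[OF spray_mem[OF S v(1)]] that spray_fst[OF S v(1)] by simp
      ultimately show ?thesis by simp
    qed
    then have "?R \<longleftrightarrow> (\<forall>\<Phi>\<in>tangent_atlas A. ?v \<in> fst \<Phi> \<longrightarrow>
        snd (velocity (tangent_atlas A) (velocity A \<gamma>) t) \<Phi> = snd (S ?v) \<Phi>)"
      unfolding prod_eq_iff fun_eq_iff using spray_fst[OF S v(1)] by auto
    also have "\<dots> \<longleftrightarrow> ?L"
      using * v(2) by (auto simp: tangent_atlas_def)
    finally show ?thesis by blast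
  qed
  then show ?thesis
    unfolding spray_geodesics_def by auto
qed

lemma spray_geodesic_cong:
  assumes \<gamma>: "(I, \<gamma>) \<in> spray_geodesics A S" and eq: "\<And>t. t \<in> I \<Longrightarrow> \<gamma> t = \<delta> t"
  shows "(I, \<delta>) \<in> spray_geodesics A S"
proof -
  have reg: "regular_curve A (I, \<gamma>)"
    using \<gamma> by (simp add: spray_geodesics_def)
  have I: "open I" by (rule regular_curveD(1)[OF reg])
  have "((\<lambda>s. vector_derivative (snd \<phi> \<circ> \<delta>) (at s))
           has_vector_derivative spray_coeff A S \<phi> (velocity A \<delta> t)) (at t)"
    if t: "t \<in> I" and \<phi>: "\<phi> \<in> A" "\<delta> t \<in> fst \<phi>" for t \<phi>
  proof -
    have "((\<lambda>s. vector_derivative (snd \<phi> \<circ> \<gamma>) (at s))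
           has_vector_derivative spray_coeff A S \<phi> (velocity A \<gamma> t)) (at t)"
      using \<gamma> t \<phi> eq[OF t] by (simp add: spray_geodesics_def)
    then have "((\<lambda>s. vector_derivative (snd \<phi> \<circ> \<delta>) (at s))
           has_vector_derivative spray_coeff A S \<phi> (velocity A \<gamma> t)) (at t)"
      by (rule has_vector_derivative_transform_within_open[OF _ I t])
        (rule vector_derivative_cong_open[OF I], simp_all add: eq)
    then show ?thesis
      using velocity_cong_open[where A=A and \<gamma>=\<gamma> and \<delta>=\<delta>, OF I t eq] by simp
  qed
  then show ?thesis
    using regular_curve_cong[OF reg eq] by (simp add: spray_geodesics_def)
qed

text \<open>Both sides of the geodesic equation scale by \<open>a\<^sup>2\<close>: the acceleration by the chain rule, the
  coefficients of the spray by homogeneity.\<close>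

lemma spray_geodesic_affine:
  assumes S: "spray A S" and \<gamma>: "(I, \<gamma>) \<in> spray_geodesics A S" and a: "a > 0"
  shows "({t. a * t + b \<in> I}, \<gamma> \<circ> (\<lambda>t. a * t + b)) \<in> spray_geodesics A S"
proof -
  let ?\<theta> = "\<lambda>t. a * t + b" and ?J = "{t. a * t + b \<in> I}"
  have reg: "regular_curve A (I, \<gamma>)"
    using \<gamma> by (simp add: spray_geodesics_def)
  note sm = regular_curveD(4)[OF reg]
  have J: "open ?J"
    by (rule open_affine_preimage[OF regular_curveD(1)[OF reg]])
  have D: "(?\<theta> has_real_derivative a) (at t)" for t
    by (auto intro!: derivative_eq_intros)
  note vel = velocity_curve_reparam[where \<theta>="?\<theta>", OF sm _ D]
  have "((\<lambda>s. vector_derivative (snd \<phi> \<circ> (\<gamma> \<circ> ?\<theta>)) (at s))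
           has_vector_derivative spray_coeff A S \<phi> (velocity A (\<gamma> \<circ> ?\<theta>) t)) (at t)"
    if t: "?\<theta> t \<in> I" and \<phi>: "\<phi> \<in> A" "\<gamma> (?\<theta> t) \<in> fst \<phi>" for t \<phi>
  proof -
    define U where "U = {s. ?\<theta> s \<in> {s \<in> I. \<gamma> s \<in> fst \<phi>}}"
    have "open {s \<in> I. \<gamma> s \<in> fst \<phi>}"
      using sm \<phi>(1) by (simp add: smooth_curve_iff)
    then have U: "open U" "t \<in> U"
      using t \<phi>(2) by (simp_all add: U_def open_affine_preimage del: mem_Collect_eq) simp
    define w where "w s = vector_derivative (snd \<phi> \<circ> \<gamma>) (at s)" for s
    have "(w has_vector_derivative spray_coeff A S \<phi> (velocity A \<gamma> (?\<theta> t))) (at (?\<theta> t))"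
      using \<gamma> t \<phi> by (simp add: spray_geodesics_def w_def[abs_def])
    then have "(w \<circ> ?\<theta> has_vector_derivative a *\<^sub>R spray_coeff A S \<phi> (velocity A \<gamma> (?\<theta> t))) (at t)"
      using D by (intro vector_diff_chain_at) (simp_all add: has_real_derivative_iff_has_vector_derivative)
    then have "((\<lambda>s. a *\<^sub>R (w \<circ> ?\<theta>) s) has_vector_derivative
        a *\<^sub>R a *\<^sub>R spray_coeff A S \<phi> (velocity A \<gamma> (?\<theta> t))) (at t)"
      by (rule bounded_linear.has_vector_derivative[OF bounded_linear_scaleR_right])
    also have "a *\<^sub>R a *\<^sub>R spray_coeff A S \<phi> (velocity A \<gamma> (?\<theta> t)) =
        spray_coeff A S \<phi> (velocity A (\<gamma> \<circ> ?\<theta>) t)"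
      using spray_coeff_homogeneous[OF S regular_curveD(5)[OF reg t] \<phi>(1) _ a] \<phi>(2) vel[OF t]
      by (simp add: power2_eq_square)
    finally show ?thesis
    proof (rule has_vector_derivative_transform_within_open[OF _ U])
      fix s assume "s \<in> U"
      then have s: "?\<theta> s \<in> I" "\<gamma> (?\<theta> s) \<in> fst \<phi>" by (simp_all add: U_def)
      then show "a *\<^sub>R (w \<circ> ?\<theta>) s = vector_derivative (snd \<phi> \<circ> (\<gamma> \<circ> ?\<theta>)) (at s)"
        using arg_cong[OF vel[OF s(1)], of "\<lambda>v. snd v \<phi>"] \<phi>(1)
        by (simp add: snd_velocity tangent_scale_def w_def)
    qed
  qed
  then show ?thesis
    using regular_curve_affine[OF reg a] by (simp add: spray_geodesics_def)
qed

text \<open>Applied to the inverse of a diffeomorphism, this shows that diffeomorphisms preserve nonzero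
  vectors.\<close>

lemma tangent_map_0:
  assumes "smooth_map A (points A) B f" "v \<in> tangent_vectors A" "v \<notin> nonzero_tangent_vectors A"
  shows "snd (tangent_map A B f v) = (\<lambda>_. 0)"
proof
  fix \<psi>
  obtain \<phi> where \<phi>: "\<phi> \<in> A" "fst v \<in> fst \<phi>"
    using tangent_vector_in_chart[OF assms(2)] .
  show "snd (tangent_map A B f v) \<psi> = 0"
  proof (cases "\<psi> \<in> B \<and> f (fst v) \<in> fst \<psi>")
    case True
    moreover have "snd v \<phi> = 0"
      using nonzero_tangent_vector_iff[OF assms(2) \<phi>] assms(3) by simp
    ultimately show ?thesis
      using tangent_map_chart[OF assms(1,2) \<phi>, of \<psi>] linear_0[OF linear_frechet_derivative[OF
          smooth_map_chart_differentiable[OF assms(1) \<phi>(1) _ \<phi>(2), of \<psi>]]]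
      by simp
  next
    case False
    then show ?thesis
      unfolding tangent_map_def Let_def snd_conv by (rule if_not_P)
  qed
qed

text \<open>Applying \<open>f\<^sub>*\<^sub>*\<close> to both sides of the chart-free geodesic equation of \<open>\<gamma>\<close> gives that of
  \<open>f \<circ> \<gamma>\<close>, by the chain rule and the invariance of \<open>S\<close>. The inverse \<open>f'\<close> ensures that the image
  curve is again regular.\<close>

lemma spray_geodesic_image:
  assumes S: "spray A S"
    and f: "smooth_map A (points A) A f" and f': "smooth_map A (points A) A f'"
    and inverse: "\<And>p. p \<in> points A \<Longrightarrow> f' (f p) = p"
    and invariant: "\<And>v. v \<in> nonzero_tangent_vectors A \<Longrightarrow> S (tangent_map A A f v) =
        tangent_map (tangent_atlas A) (tangent_atlas A) (tangent_map A A f) (S v)"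
    and \<gamma>: "(I, \<gamma>) \<in> spray_geodesics A S"
  shows "(I, f \<circ> \<gamma>) \<in> spray_geodesics A S"
proof -
  have reg: "regular_curve A (I, \<gamma>)"
    and geo: "\<And>t. t \<in> I \<Longrightarrow> velocity (tangent_atlas A) (velocity A \<gamma>) t = S (velocity A \<gamma> t)"
    using \<gamma> by (simp_all add: spray_geodesic_iff[OF S])
  note reg' = regular_curveD[OF reg]
  have sm: "smooth_map euclidean_atlas I A (f \<circ> \<gamma>)"
    by (rule smooth_map_curve[OF f reg'(4)])
  have vel: "velocity A (f \<circ> \<gamma>) t = tangent_map A A f (velocity A \<gamma> t)" if "t \<in> I" for t
    by (rule velocity_smooth_map[OF f reg'(4) that])
  have nonzero: "velocity A (f \<circ> \<gamma>) t \<in> nonzero_tangent_vectors A" if t: "t \<in> I" for t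
  proof (rule ccontr)
    assume "velocity A (f \<circ> \<gamma>) t \<notin> nonzero_tangent_vectors A"
    then have "snd (velocity A (f' \<circ> (f \<circ> \<gamma>)) t) = (\<lambda>_. 0)"
      unfolding velocity_smooth_map[OF f' sm t] by (rule tangent_map_0[OF f' velocity_mem[OF sm t]])
    moreover have "velocity A (f' \<circ> (f \<circ> \<gamma>)) t = velocity A \<gamma> t"
      using reg'(4) inverse
      by (intro velocity_cong_open[OF reg'(1) t]) (auto simp: smooth_curve_iff image_subset_iff)
    ultimately show False
      using reg'(5)[OF t] by (simp add: nonzero_tangent_vectors_def)
  qed
  have "velocity (tangent_atlas A) (velocity A (f \<circ> \<gamma>)) t = S (velocity A (f \<circ> \<gamma>) t)" if t: "t \<in> I" for t
  proof -
    have "velocity (tangent_atlas A) (velocity A (f \<circ> \<gamma>)) t =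
        velocity (tangent_atlas A) (tangent_map A A f \<circ> velocity A \<gamma>) t"
      by (rule velocity_cong_open[OF reg'(1) t]) (simp add: vel)
    also have "\<dots> = tangent_map (tangent_atlas A) (tangent_atlas A) (tangent_map A A f)
        (S (velocity A \<gamma> t))"
      unfolding velocity_velocity_smooth_map[OF f reg'(4) t] geo[OF t] ..
    also have "\<dots> = S (velocity A (f \<circ> \<gamma>) t)"
      unfolding vel[OF t] by (rule invariant[OF reg'(5)[OF t], symmetric])
    finally show ?thesis .
  qed
  then show ?thesis
    using reg' sm nonzero by (simp add: spray_geodesic_iff[OF S] regular_curve_def)
qed

end

section \<open>Energy functions\<close>

lemma frechet_derivative_linear: "bounded_linear L \<Longrightarrow> frechet_derivative L (at x) = L"
  using frechet_derivative_at bounded_linear_imp_has_derivative by metis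

text \<open>Euler's identity, from differentiating \<open>c \<mapsto> f (x, c y) = c\<^sup>n f (x, y)\<close> at \<open>c = 1\<close> in two ways.\<close>

lemma euler_homogeneous:
  fixes f :: "'a::euclidean_space \<times> 'b::euclidean_space \<Rightarrow> real"
  assumes f: "f differentiable (at (x, y))"
    and hom: "\<And>c. c > 0 \<Longrightarrow> f (x, c *\<^sub>R y) = c ^ n * f (x, y)"
  shows "frechet_derivative f (at (x, y)) (0, y) = real n * f (x, y)"
proof -
  have "((\<lambda>c. (x, c *\<^sub>R y)) has_vector_derivative (0, y)) (at 1)"
    by (auto intro!: derivative_eq_intros has_vector_derivative_Pair)
  moreover have "(f has_derivative frechet_derivative f (at (x, y)))
      (at (x, 1 *\<^sub>R y) within range (\<lambda>c. (x, c *\<^sub>R y)))"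
    using f by (simp add: frechet_derivative_works has_derivative_at_withinI)
  ultimately have "(f \<circ> (\<lambda>c. (x, c *\<^sub>R y)) has_vector_derivative
      frechet_derivative f (at (x, y)) (0, y)) (at 1)"
    by (rule vector_derivative_diff_chain_within)
  then have "((\<lambda>c. c ^ n * f (x, y)) has_vector_derivative
      frechet_derivative f (at (x, y)) (0, y)) (at (1::real))"
    by (rule has_vector_derivative_transform_within_open[of _ _ _ "{0<..}"]) (simp_all add: hom)
  moreover have "((\<lambda>c::real. c ^ n * f (x, y)) has_vector_derivative real n * f (x, y)) (at 1)"
    unfolding has_real_derivative_iff_has_vector_derivative[symmetric]
    by (auto intro!: derivative_eq_intros)
  ultimately show ?thesis
    by (rule vector_derivative_unique_at)
qed

context smooth_atlas
begin

lemma smooth_on_energy_coords: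
  assumes E: "finsler_metric A E" and \<phi>: "\<phi> \<in> A"
  shows "smooth_on (snd \<phi> ` fst \<phi> \<times> (- {0})) (energy_coords A E \<phi>)"
proof -
  let ?\<Phi> = "tangent_chart A \<phi>" and ?id = "(UNIV, \<lambda>x. x) :: (real, real) chart"
  have "smooth_map (tangent_atlas A) (nonzero_tangent_vectors A) euclidean_atlas E"
    using E by (simp add: finsler_metric_def)
  moreover have "?\<Phi> \<in> tangent_atlas A" "?id \<in> euclidean_atlas"
    using \<phi> by (simp_all add: tangent_atlas_def euclidean_atlas_def)
  ultimately have "smooth_on (snd ?\<Phi> ` {v \<in> nonzero_tangent_vectors A \<inter> fst ?\<Phi>. E v \<in> fst ?id})
      (snd ?id \<circ> E \<circ> chart_inv ?\<Phi>)"
    unfolding smooth_map_def by blast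
  then have "smooth_on (snd ?\<Phi> ` {v \<in> nonzero_tangent_vectors A \<inter> fst ?\<Phi>. E v \<in> fst ?id})
      (energy_coords A E \<phi>)"
    by (simp add: energy_coords_def comp_def)
  moreover have "snd \<phi> ` fst \<phi> \<times> (- {0 :: 'e}) \<subseteq>
      snd ?\<Phi> ` {v \<in> nonzero_tangent_vectors A \<inter> fst ?\<Phi>. E v \<in> fst ?id}"
  proof
    fix z :: "'e \<times> 'e" assume z: "z \<in> snd \<phi> ` fst \<phi> \<times> (- {0})"
    note c = nonzero_tangent_chart_coords[OF \<phi> z]
    show "z \<in> snd ?\<Phi> ` {v \<in> nonzero_tangent_vectors A \<inter> fst ?\<Phi>. E v \<in> fst ?id}"
    proof (rule image_eqI)
      show "z = snd ?\<Phi> (chart_inv ?\<Phi> z)"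
        using c by (simp add: prod_eq_iff)
      show "chart_inv ?\<Phi> z \<in> {v \<in> nonzero_tangent_vectors A \<inter> fst ?\<Phi>. E v \<in> fst ?id}"
        using c by simp
    qed
  qed
  ultimately show ?thesis
    by (rule smooth_on_subset)
qed

lemma open_nonzero_coords: "\<phi> \<in> A \<Longrightarrow> open (snd \<phi> ` fst \<phi> \<times> (- {0 :: 'e}))"
  by (intro open_Times open_chart_image open_Compl closed_singleton)

lemma energy_coords_differentiable:
  assumes "finsler_metric A E" "\<phi> \<in> A" "x \<in> snd \<phi> ` fst \<phi>" "y \<noteq> 0"
  shows "energy_coords A E \<phi> differentiable (at (x, y))"
  by (rule smooth_on_imp_differentiable[OF smooth_on_energy_coords[OF assms(1,2)]]) (use assms in simp)

lemma energy_coords_homogeneous: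
  assumes E: "finsler_metric A E" and \<phi>: "\<phi> \<in> A" and x: "x \<in> snd \<phi> ` fst \<phi>" and c: "c > 0"
  shows "energy_coords A E \<phi> (x, c *\<^sub>R y) = c\<^sup>2 * energy_coords A E \<phi> (x, y)"
proof -
  let ?v = "chart_inv (tangent_chart A \<phi>) (x, y)"
  note v = tangent_chart_coords[OF \<phi> x, of y]
  have "chart_inv (tangent_chart A \<phi>) (x, c *\<^sub>R y) = tangent_scale c ?v"
    using chart_inv_tangent_chart[OF \<phi> tangent_scale_mem[OF v(1), of c]] v(2,3,5)
    by (simp add: tangent_scale_def)
  then show ?thesis
    using E v(1) c by (simp add: energy_coords_def finsler_metric_def)
qed

text \<open>From differentiating \<open>e (x, c y) = c\<^sup>2 e (x, y)\<close> with respect to \<open>(x, y)\<close>, where \<open>e\<close> is the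
  energy in coordinates.\<close>

lemma dE_scale:
  assumes E: "finsler_metric A E" and \<phi>: "\<phi> \<in> A" and x: "x \<in> snd \<phi> ` fst \<phi>" and y: "y \<noteq> 0"
    and c: "c > 0"
  shows "dE_dx A E \<phi> i (x, c *\<^sub>R y) = c\<^sup>2 * dE_dx A E \<phi> i (x, y)"
    and "dE_dy A E \<phi> i (x, c *\<^sub>R y) = c * dE_dy A E \<phi> i (x, y)"
proof -
  define e where "e = energy_coords A E \<phi>"
  define L where "L z = (fst z, c *\<^sub>R snd z)" for z :: "'e \<times> 'e"
  have L: "bounded_linear L"
    unfolding L_def[abs_def]
    by (intro bounded_linear_Pair bounded_linear_fst bounded_linear_compose[OF bounded_linear_scaleR_right]
        bounded_linear_snd)
  have e: "e differentiable (at (x, y))" "e differentiable (at (x, c *\<^sub>R y))"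
    unfolding e_def using c y by (auto intro: energy_coords_differentiable[OF E \<phi> x])
  have lin: "linear (frechet_derivative e (at (x, c *\<^sub>R y)))"
    by (rule linear_frechet_derivative[OF e(2)])
  have "frechet_derivative (e \<circ> L) (at (x, y)) = frechet_derivative (\<lambda>z. c\<^sup>2 *\<^sub>R e z) (at (x, y))"
    by (rule frechet_derivative_cong_open[OF open_nonzero_coords[OF \<phi>]])
      (use x y c in \<open>auto simp: e_def L_def energy_coords_homogeneous[OF E \<phi>]\<close>)
  moreover have "frechet_derivative (e \<circ> L) (at (x, y)) = frechet_derivative e (at (x, c *\<^sub>R y)) \<circ> L"
    using frechet_derivative_compose[of L "(x, y)" e] e(2) L bounded_linear_imp_differentiable[OF L]
    by (simp add: frechet_derivative_linear L_def)
  moreover have "frechet_derivative (\<lambda>z. c\<^sup>2 *\<^sub>R e z) (at (x, y)) =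
      (\<lambda>h. c\<^sup>2 *\<^sub>R frechet_derivative e (at (x, y)) h)"
    by (rule frechet_derivative_at[symmetric], rule has_derivative_scaleR_right)
      (use e(1) in \<open>simp add: frechet_derivative_works\<close>)
  ultimately have *: "frechet_derivative e (at (x, c *\<^sub>R y)) (h, c *\<^sub>R k) =
      c\<^sup>2 * frechet_derivative e (at (x, y)) (h, k)" for h k
    by (simp add: fun_eq_iff L_def)
  show "dE_dx A E \<phi> i (x, c *\<^sub>R y) = c\<^sup>2 * dE_dx A E \<phi> i (x, y)"
    using *[of i 0] by (simp add: dE_dx_def e_def)
  have "c * frechet_derivative e (at (x, c *\<^sub>R y)) (0, i) =
      frechet_derivative e (at (x, c *\<^sub>R y)) (0, c *\<^sub>R i)"
    using linear_cmul[OF lin, of c "(0, i)"] by simp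
  then show "dE_dy A E \<phi> i (x, c *\<^sub>R y) = c * dE_dy A E \<phi> i (x, y)"
    using *[of 0 i] c by (simp add: dE_dy_def e_def power2_eq_square)
qed

lemma sum_dE_dy:
  assumes E: "finsler_metric A E" and \<phi>: "\<phi> \<in> A" and x: "x \<in> snd \<phi> ` fst \<phi>" and y: "y \<noteq> 0"
  shows "(\<Sum>i\<in>Basis. (k \<bullet> i) * dE_dy A E \<phi> i (x, y)) =
    frechet_derivative (energy_coords A E \<phi>) (at (x, y)) (0, k)"
proof -
  let ?D = "frechet_derivative (energy_coords A E \<phi>) (at (x, y))"
  have "linear ?D"
    by (rule linear_frechet_derivative[OF energy_coords_differentiable[OF E \<phi> x y]])
  then have "linear (\<lambda>k. ?D (0, k))"
    using linear_compose[of "\<lambda>k. (0, k)" ?D] by (simp add: comp_def linear_iff)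
  from linear_eq_sum_Basis[OF this, of k] show ?thesis
    by (simp add: dE_dy_def)
qed

text \<open>Euler's identity for \<open>E\<close> and for its fibre derivatives gives
  \<open>2 E(v) = \<Sum> (\<partial>\<^sup>2E/\<partial>y\<^sup>i\<partial>y\<^sup>j) y\<^sup>i y\<^sup>j\<close>, which is positive by convexity.\<close>

lemma energy_positive:
  assumes E: "finsler_metric A E" and v: "v \<in> nonzero_tangent_vectors A"
  shows "E v > 0"
proof -
  have v': "v \<in> tangent_vectors A"
    using v nonzero_tangent_vectors_subset by blast
  obtain \<phi> where \<phi>: "\<phi> \<in> A" "fst v \<in> fst \<phi>"
    using tangent_vector_in_chart[OF v'] .
  let ?x = "snd \<phi> (fst v)" and ?y = "snd v \<phi>"
  have x: "?x \<in> snd \<phi> ` fst \<phi>" and y: "?y \<noteq> 0"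
    using \<phi>(2) v nonzero_tangent_vector_iff[OF v' \<phi>] by auto
  have "(\<Sum>i\<in>Basis. \<Sum>j\<in>Basis. fibre_hessian A E \<phi> i j (?x, ?y) * (?y \<bullet> i) * (?y \<bullet> j)) > 0"
    using E v \<phi> y by (simp add: finsler_metric_def)
  also have "(\<Sum>i\<in>Basis. \<Sum>j\<in>Basis. fibre_hessian A E \<phi> i j (?x, ?y) * (?y \<bullet> i) * (?y \<bullet> j)) =
      (\<Sum>j\<in>Basis. (?y \<bullet> j) * (\<Sum>i\<in>Basis. (?y \<bullet> i) * fibre_hessian A E \<phi> i j (?x, ?y)))"
    by (subst sum.swap) (simp add: sum_distrib_left mult_ac)
  also have "\<dots> = (\<Sum>j\<in>Basis. (?y \<bullet> j) * dE_dy A E \<phi> j (?x, ?y))"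
  proof (intro sum.cong refl arg_cong2[where f="(*)"])
    fix j :: 'e
    let ?D = "frechet_derivative (dE_dy A E \<phi> j) (at (?x, ?y))"
    have "smooth_on (snd \<phi> ` fst \<phi> \<times> (- {0})) (dE_dy A E \<phi> j)"
      unfolding dE_dy_def[abs_def]
      by (rule smooth_on_frechet_derivative[OF smooth_on_energy_coords[OF E \<phi>(1)]])
    then have d: "dE_dy A E \<phi> j differentiable (at (?x, ?y))"
      by (rule smooth_on_imp_differentiable) (use x y in simp)
    have "linear (\<lambda>k. ?D (0, k))"
      using linear_compose[OF _ linear_frechet_derivative[OF d], of "\<lambda>k. (0, k)"]
      by (simp add: comp_def linear_iff)
    from linear_eq_sum_Basis[OF this, of ?y]
    have "(\<Sum>i\<in>Basis. (?y \<bullet> i) * fibre_hessian A E \<phi> i j (?x, ?y)) = ?D (0, ?y)"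
      by (simp add: fibre_hessian_def)
    also have "\<dots> = dE_dy A E \<phi> j (?x, ?y)"
      using euler_homogeneous[OF d, of 1] dE_scale(2)[OF E \<phi>(1) x y] by simp
    finally show "(\<Sum>i\<in>Basis. (?y \<bullet> i) * fibre_hessian A E \<phi> i j (?x, ?y)) = dE_dy A E \<phi> j (?x, ?y)" .
  qed
  also have "\<dots> = 2 * energy_coords A E \<phi> (?x, ?y)"
    using euler_homogeneous[OF energy_coords_differentiable[OF E \<phi>(1) x y], of 2]
      energy_coords_homogeneous[OF E \<phi>(1) x]
    by (simp add: sum_dE_dy[OF E \<phi>(1) x y])
  also have "energy_coords A E \<phi> (?x, ?y) = E v"
    using chart_inv_tangent_chart[OF \<phi>(1) v' \<phi>(2)] by (simp add: energy_coords_def)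
  finally show ?thesis by simp
qed

lemma energy_geodesicD:
  assumes "(I, \<gamma>) \<in> energy_geodesics A E"
  shows "regular_curve A (I, \<gamma>)"
    and "\<And>t \<phi> i. t \<in> I \<Longrightarrow> \<phi> \<in> A \<Longrightarrow> \<gamma> t \<in> fst \<phi> \<Longrightarrow> i \<in> Basis \<Longrightarrow>
      ((\<lambda>s. dE_dy A E \<phi> i (snd (tangent_chart A \<phi>) (velocity A \<gamma> s))) has_real_derivative
        dE_dx A E \<phi> i (snd (tangent_chart A \<phi>) (velocity A \<gamma> t))) (at t)"
  using assms unfolding energy_geodesics_def by blast+

text \<open>Conservation of energy. By Euler's identity \<open>2 E = y\<^sup>i \<partial>E/\<partial>y\<^sup>i\<close>; along a solution of the
  Euler-Lagrange equations the right-hand side has derivative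
  \<open>y\<^sup>i \<partial>E/\<partial>x\<^sup>i + (y\<^sup>i)' \<partial>E/\<partial>y\<^sup>i\<close>, which is also the derivative of \<open>E\<close>. So \<open>E\<close> and
  \<open>2 E\<close> have the same derivative.\<close>

lemma energy_constant_along_energy_geodesic:
  assumes E: "finsler_metric A E" and \<gamma>: "(I, \<gamma>) \<in> energy_geodesics A E"
    and st: "s \<in> I" "t \<in> I"
  shows "E (velocity A \<gamma> s) = E (velocity A \<gamma> t)"
proof -
  note reg = regular_curveD[OF energy_geodesicD(1)[OF \<gamma>]]
  have "((\<lambda>s. E (velocity A \<gamma> s)) has_real_derivative 0) (at t)" if t: "t \<in> I" for t
  proof -
    have v: "velocity A \<gamma> t \<in> tangent_vectors A"
      by (rule velocity_mem[OF reg(4) t])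
    obtain \<phi> where \<phi>: "\<phi> \<in> A" "\<gamma> t \<in> fst \<phi>"
      using tangent_vector_in_chart[OF v] by auto
    obtain U where U: "open U" "t \<in> U" "U \<subseteq> I" "\<gamma> ` U \<subseteq> fst \<phi>"
      using curve_near[OF reg(4) t \<phi>] by blast
    define e where "e = energy_coords A E \<phi>"
    define c where "c = snd (tangent_chart A \<phi>) \<circ> velocity A \<gamma>"
    define y where "y s = vector_derivative (snd \<phi> \<circ> \<gamma>) (at s)" for s
    define y' where "y' = vector_derivative y (at t)"
    have cy: "c s = (snd \<phi> (\<gamma> s), y s)" "snd \<phi> (\<gamma> s) \<in> snd \<phi> ` fst \<phi>" "y s \<noteq> 0"
      "E (velocity A \<gamma> s) = e (c s)" if "s \<in> U" for s
    proof -
      have s: "s \<in> I" "\<gamma> s \<in> fst \<phi>" using that U by auto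
      have w: "velocity A \<gamma> s \<in> tangent_vectors A"
        by (rule velocity_mem[OF reg(4) s(1)])
      show *: "c s = (snd \<phi> (\<gamma> s), y s)" "snd \<phi> (\<gamma> s) \<in> snd \<phi> ` fst \<phi>"
        using s(2) \<phi>(1) by (simp_all add: c_def y_def snd_velocity)
      show "y s \<noteq> 0"
        using nonzero_tangent_vector_iff[OF w \<phi>(1)] s \<phi>(1) reg(5) by (simp add: y_def snd_velocity)
      show "E (velocity A \<gamma> s) = e (c s)"
        using chart_inv_tangent_chart[OF \<phi>(1) w] s(2) by (simp add: e_def energy_coords_def c_def)
    qed
    have e: "e differentiable (at (c s))" if "s \<in> U" for s
      using energy_coords_differentiable[OF E \<phi>(1) cy(2,3)[OF that]] cy(1)[OF that] by (simp add: e_def)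
    let ?D = "frechet_derivative e (at (c t))"
    have D: "linear ?D"
      by (rule linear_frechet_derivative[OF e[OF U(2)]])
    have "(c has_vector_derivative (y t, y')) (at t)"
      using velocity_curve_has_vector_derivative[OF reg(4) t \<phi>]
      by (simp add: c_def y'_def y_def[abs_def])
    then have "(e \<circ> c has_vector_derivative ?D (y t, y')) (at t)"
      by (rule vector_derivative_diff_chain_within)
        (rule has_derivative_at_withinI[OF e[OF U(2), unfolded frechet_derivative_works]])
    then have ec: "(e \<circ> c has_real_derivative ?D (y t, y')) (at t)"
      by (simp add: has_real_derivative_iff_has_vector_derivative)
    have two_e: "(\<Sum>i\<in>Basis. (y s \<bullet> i) * dE_dy A E \<phi> i (c s)) = 2 * (e \<circ> c) s" if "s \<in> U" for s
      using euler_homogeneous[OF energy_coords_differentiable[OF E \<phi>(1) cy(2,3)[OF that]], of 2]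
        energy_coords_homogeneous[OF E \<phi>(1) cy(2)[OF that]] sum_dE_dy[OF E \<phi>(1) cy(2,3)[OF that]]
      by (simp add: cy(1)[OF that] e_def)
    have "y differentiable (at t)"
      using curve_derivative_differentiable[OF reg(4) t \<phi>] by (simp add: y_def[abs_def])
    then have y: "(y has_vector_derivative y') (at t)"
      by (simp add: y'_def vector_derivative_works)
    have yi: "((\<lambda>s. y s \<bullet> i) has_real_derivative y' \<bullet> i) (at t)" for i
      using bounded_linear.has_vector_derivative[OF bounded_linear_inner_left y]
      by (simp add: has_real_derivative_iff_has_vector_derivative)
    have "((\<lambda>s. \<Sum>i\<in>Basis. (y s \<bullet> i) * dE_dy A E \<phi> i (c s)) has_real_derivative
        (\<Sum>i\<in>Basis. (y t \<bullet> i) * dE_dx A E \<phi> i (c t) + (y' \<bullet> i) * dE_dy A E \<phi> i (c t))) (at t)"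
    proof (intro DERIV_sum DERIV_mult' yi)
      fix i :: 'e assume "i \<in> Basis"
      then show "((\<lambda>s. dE_dy A E \<phi> i (c s)) has_real_derivative dE_dx A E \<phi> i (c t)) (at t)"
        using energy_geodesicD(2)[OF \<gamma> t \<phi>, of i] by (simp add: c_def)
    qed
    moreover have "(\<Sum>i\<in>Basis. (y t \<bullet> i) * dE_dx A E \<phi> i (c t) + (y' \<bullet> i) * dE_dy A E \<phi> i (c t)) =
        ?D (y t, y')"
    proof -
      have "linear (\<lambda>k. ?D (k, 0))"
        using linear_compose[OF _ D, of "\<lambda>k. (k, 0)"] by (simp add: comp_def linear_iff)
      from linear_eq_sum_Basis[OF this, of "y t"]
      have "(\<Sum>i\<in>Basis. (y t \<bullet> i) * dE_dx A E \<phi> i (c t)) = ?D (y t, 0)"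
        by (simp add: dE_dx_def e_def)
      moreover have "(\<Sum>i\<in>Basis. (y' \<bullet> i) * dE_dy A E \<phi> i (c t)) = ?D (0, y')"
        using sum_dE_dy[OF E \<phi>(1) cy(2,3)[OF U(2)]] by (simp add: cy(1)[OF U(2)] e_def)
      ultimately show ?thesis
        using linear_add[OF D, of "(y t, 0)" "(0, y')"] by (simp add: sum.distrib)
    qed
    ultimately have "((\<lambda>s. 2 * (e \<circ> c) s) has_real_derivative ?D (y t, y')) (at t)"
      using has_field_derivative_transform_within_open[OF _ U(1,2) two_e] by simp
    \<comment> \<open>the derivative \<open>d\<close> of the energy satisfies \<open>d = 2 d\<close>\<close>
    from DERIV_unique[OF this DERIV_cmult[OF ec, of 2]] have "?D (y t, y') = 0" by simp
    with ec have "(e \<circ> c has_real_derivative 0) (at t)" by simp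
    then show ?thesis
      by (rule has_field_derivative_transform_within_open[OF _ U(1,2)]) (simp add: cy(4))
  qed
  then obtain d where "\<And>t. t \<in> I \<Longrightarrow> E (velocity A \<gamma> t) = d"
    using has_field_derivative_zero_constant[OF is_interval_convex[OF reg(2)],
        of "\<lambda>s. E (velocity A \<gamma> s)"] has_field_derivative_at_within
    by blast
  then show ?thesis using st by simp
qed

lemma energy_geodesic_cong:
  assumes \<gamma>: "(I, \<gamma>) \<in> energy_geodesics A E" and eq: "\<And>t. t \<in> I \<Longrightarrow> \<gamma> t = \<delta> t"
  shows "(I, \<delta>) \<in> energy_geodesics A E"
proof -
  note reg = energy_geodesicD(1)[OF \<gamma>]
  have I: "open I" by (rule regular_curveD(1)[OF reg])
  have vel: "velocity A \<gamma> t = velocity A \<delta> t" if "t \<in> I" for t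
    by (rule velocity_cong_open[OF I that eq])
  have "((\<lambda>s. dE_dy A E \<phi> i (snd (tangent_chart A \<phi>) (velocity A \<delta> s))) has_real_derivative
        dE_dx A E \<phi> i (snd (tangent_chart A \<phi>) (velocity A \<delta> t))) (at t)"
    if t: "t \<in> I" and \<phi>: "\<phi> \<in> A" "\<delta> t \<in> fst \<phi>" and i: "i \<in> Basis" for t \<phi> i
    unfolding vel[OF t, symmetric]
    by (rule has_field_derivative_transform_within_open[OF energy_geodesicD(2)[OF \<gamma> t \<phi>(1) _ i] I t])
      (use \<phi>(2) eq[OF t] vel in simp_all)
  then show ?thesis
    using regular_curve_cong[OF reg eq] by (simp add: energy_geodesics_def)
qed

text \<open>Both sides of the Euler-Lagrange equations scale by \<open>a\<^sup>2\<close>, as \<open>\<partial>E/\<partial>y\<close> and \<open>\<partial>E/\<partial>x\<close> are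
  homogeneous in \<open>y\<close> of degree 1 and 2.\<close>

lemma energy_geodesic_affine:
  assumes E: "finsler_metric A E" and \<gamma>: "(I, \<gamma>) \<in> energy_geodesics A E" and a: "a > 0"
  shows "({t. a * t + b \<in> I}, \<gamma> \<circ> (\<lambda>t. a * t + b)) \<in> energy_geodesics A E"
proof -
  let ?\<theta> = "\<lambda>t. a * t + b"
  note reg = energy_geodesicD(1)[OF \<gamma>]
  note sm = regular_curveD(4)[OF reg]
  have D: "(?\<theta> has_real_derivative a) (at t)" for t
    by (auto intro!: derivative_eq_intros)
  note vel = velocity_curve_reparam[where \<theta>="?\<theta>", OF sm _ D]
  have "((\<lambda>s. dE_dy A E \<phi> i (snd (tangent_chart A \<phi>) (velocity A (\<gamma> \<circ> ?\<theta>) s))) has_real_derivative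
        dE_dx A E \<phi> i (snd (tangent_chart A \<phi>) (velocity A (\<gamma> \<circ> ?\<theta>) t))) (at t)"
    if t: "?\<theta> t \<in> I" and \<phi>: "\<phi> \<in> A" "\<gamma> (?\<theta> t) \<in> fst \<phi>" and i: "i \<in> Basis" for t \<phi> i
  proof -
    define U where "U = {s. ?\<theta> s \<in> {s \<in> I. \<gamma> s \<in> fst \<phi>}}"
    have "open {s \<in> I. \<gamma> s \<in> fst \<phi>}"
      using sm \<phi>(1) by (simp add: smooth_curve_iff)
    then have U: "open U" "t \<in> U"
      using t \<phi>(2) by (simp_all add: U_def open_affine_preimage del: mem_Collect_eq) simp
    define p where "p s = dE_dy A E \<phi> i (snd (tangent_chart A \<phi>) (velocity A \<gamma> s))" for s
    define q where "q s = dE_dx A E \<phi> i (snd (tangent_chart A \<phi>) (velocity A \<gamma> s))" for s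
    have scale: "dE_dy A E \<phi> i (snd (tangent_chart A \<phi>) (velocity A (\<gamma> \<circ> ?\<theta>) s)) = a * p (?\<theta> s)"
      "dE_dx A E \<phi> i (snd (tangent_chart A \<phi>) (velocity A (\<gamma> \<circ> ?\<theta>) s)) = a\<^sup>2 * q (?\<theta> s)"
      if "s \<in> U" for s
    proof -
      have s: "?\<theta> s \<in> I" "\<gamma> (?\<theta> s) \<in> fst \<phi>" using that by (simp_all add: U_def)
      have "snd (velocity A \<gamma> (?\<theta> s)) \<phi> \<noteq> 0"
        using nonzero_tangent_vector_iff[OF velocity_mem[OF sm s(1)] \<phi>(1)] s(2)
          regular_curveD(5)[OF reg s(1)] by simp
      from dE_scale[OF E \<phi>(1) _ this a, of "snd \<phi> (\<gamma> (?\<theta> s))" i]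
      show "dE_dy A E \<phi> i (snd (tangent_chart A \<phi>) (velocity A (\<gamma> \<circ> ?\<theta>) s)) = a * p (?\<theta> s)"
        "dE_dx A E \<phi> i (snd (tangent_chart A \<phi>) (velocity A (\<gamma> \<circ> ?\<theta>) s)) = a\<^sup>2 * q (?\<theta> s)"
        using s(2) by (simp_all add: vel[OF s(1)] p_def q_def tangent_scale_def)
    qed
    have "(p has_real_derivative q (?\<theta> t)) (at (?\<theta> t))"
      using energy_geodesicD(2)[OF \<gamma> t \<phi> i] by (simp add: p_def[abs_def] q_def)
    from DERIV_cmult[OF DERIV_chain2[OF this D], of a]
    have "((\<lambda>s. a * p (?\<theta> s)) has_real_derivative a\<^sup>2 * q (?\<theta> t)) (at t)"
      by (simp add: power2_eq_square mult_ac)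
    then show ?thesis
      unfolding scale(2)[OF U(2)]
      by (rule has_field_derivative_transform_within_open[OF _ U]) (simp only: scale(1))
  qed
  then show ?thesis
    using regular_curve_affine[OF reg a] by (simp add: energy_geodesics_def)
qed

end

section \<open>Smooth actions and homogeneous geodesics\<close>

lemma smooth_on_Pair_const:
  fixes c :: "'b::euclidean_space"
  shows "smooth_on S (\<lambda>x::'a::euclidean_space. (c, x))"
  unfolding smooth_on_def
proof
  fix k
  show "Ck_on k S (\<lambda>x::'a. (c, x))"
  proof (cases k)
    case 0
    then show ?thesis by (simp add: continuous_on_Pair)
  next
    case (Suc n)
    have D: "((\<lambda>x::'a. (c, x)) has_derivative (\<lambda>v. (0, v))) (at x)" for x
      by (intro has_derivative_Pair has_derivative_const has_derivative_ident)
    show ?thesis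
      by (simp add: Suc Ck_on_const differentiableI[OF D] frechet_derivative_at[OF D, symmetric])
  qed
qed

text \<open>This turns joint smoothness of an action into smoothness of each of its translations.\<close>

lemma smooth_map_slice:
  assumes B: "\<And>\<xi>. \<xi> \<in> B \<Longrightarrow> inj_on (snd \<xi>) (fst \<xi>)" and A: "\<And>\<phi>. \<phi> \<in> A \<Longrightarrow> inj_on (snd \<phi>) (fst \<phi>)"
    and F: "smooth_map (product_atlas B A) (points B \<times> points A) C F" and b: "b \<in> points B"
  shows "smooth_map A (points A) C (\<lambda>p. F (b, p))"
  unfolding smooth_map_def
proof (intro conjI ballI)
  show "(\<lambda>p. F (b, p)) ` points A \<subseteq> points C"
    using F b by (auto simp: smooth_map_def)
  fix \<phi> \<psi> assume \<phi>: "\<phi> \<in> A" and \<psi>: "\<psi> \<in> C"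
  obtain \<xi> where \<xi>: "\<xi> \<in> B" "b \<in> fst \<xi>"
    using b by (auto simp: points_def)
  define K where "K = (fst \<xi> \<times> fst \<phi>, map_prod (snd \<xi>) (snd \<phi>))"
  define U where "U = snd K ` {q \<in> (points B \<times> points A) \<inter> fst K. F q \<in> fst \<psi>}"
  let ?D = "snd \<phi> ` {p \<in> points A \<inter> fst \<phi>. F (b, p) \<in> fst \<psi>}"
  have "K \<in> product_atlas B A"
    unfolding product_atlas_def by (rule image_eqI[of _ _ "(\<xi>, \<phi>)"]) (simp_all add: K_def \<xi>(1) \<phi>)
  then have U: "open U" "smooth_on U (snd \<psi> \<circ> F \<circ> chart_inv K)"
    using F \<psi> unfolding smooth_map_def U_def by blast+
  have inj: "inj_on (snd K) (fst K)"
    using map_prod_inj_on[OF B[OF \<xi>(1)] A[OF \<phi>]] by (simp add: K_def)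
  have mem_U: "(snd \<xi> b, snd \<phi> p) \<in> U" if "p \<in> points A" "p \<in> fst \<phi>" "F (b, p) \<in> fst \<psi>" for p
    unfolding U_def by (rule image_eqI[of _ _ "(b, p)"]) (simp_all add: K_def that b \<xi>(2))
  have D_eq: "?D = {x. (snd \<xi> b, x) \<in> U}"
  proof (intro equalityI subsetI)
    fix x assume "x \<in> ?D"
    then obtain p where p: "p \<in> points A" "p \<in> fst \<phi>" "F (b, p) \<in> fst \<psi>" "x = snd \<phi> p"
      by auto
    show "x \<in> {x. (snd \<xi> b, x) \<in> U}"
      using mem_U[OF p(1-3)] p(4) by simp
  next
    fix x assume "x \<in> {x. (snd \<xi> b, x) \<in> U}"
    then obtain b' p where *: "b' \<in> fst \<xi>" "p \<in> fst \<phi>" "p \<in> points A" "F (b', p) \<in> fst \<psi>"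
      "snd \<xi> b' = snd \<xi> b" "snd \<phi> p = x"
      by (auto simp: U_def K_def)
    then have "b' = b"
      using inj_onD[OF B[OF \<xi>(1)]] \<xi>(2) by blast
    then show "x \<in> ?D" using * by auto
  qed
  have "{x. (snd \<xi> b, x) \<in> U} = (\<lambda>x. (snd \<xi> b, x)) -` U" by auto
  then show D: "open ?D"
    unfolding D_eq by (simp add: open_vimage[OF U(1)] continuous_on_Pair)
  show "smooth_on ?D (snd \<psi> \<circ> (\<lambda>p. F (b, p)) \<circ> chart_inv \<phi>)"
  proof (rule smooth_on_cong[OF D])
    show "smooth_on ?D ((snd \<psi> \<circ> F \<circ> chart_inv K) \<circ> (\<lambda>x. (snd \<xi> b, x)))"
      by (rule smooth_on_compose[OF D U(1) _ smooth_on_Pair_const U(2)]) (use D_eq in blast)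
    fix x assume "x \<in> ?D"
    then obtain p where p: "p \<in> fst \<phi>" "x = snd \<phi> p" by auto
    have "chart_inv K (snd \<xi> b, x) = (b, p)"
      using chart_inv_left[OF inj, of "(b, p)"] p \<xi>(2) by (simp add: K_def)
    then show "((snd \<psi> \<circ> F \<circ> chart_inv K) \<circ> (\<lambda>x. (snd \<xi> b, x))) x =
        (snd \<psi> \<circ> (\<lambda>p. F (b, p)) \<circ> chart_inv \<phi>) x"
      using chart_inv_left[OF A[OF \<phi>] p(1)] p(2) by simp
  qed
qed simp

lemma tangent_scale_1 [simp]: "tangent_scale 1 v = v"
  by (simp add: tangent_scale_def)

locale homogeneous_manifold = smooth_atlas A
  for A :: "('a, 'e::euclidean_space) atlas" +
  fixes G :: "('g, 'x) monoid_scheme"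
    and \<A> :: "('g, 'h::euclidean_space) atlas"
    and act :: "'g \<Rightarrow> 'a \<Rightarrow> 'a"
  assumes lie_group: "lie_group G \<A>"
    and action: "smooth_transitive_action G \<A> A act"
begin

sublocale transitive_action G "points A" act
  using action by (simp add: smooth_transitive_action_def)

lemma group_G: "group G"
  using lie_group by (simp add: lie_group_def)

lemma points_G: "points \<A> = carrier G"
  using lie_group by (simp add: lie_group_def)

lemma smooth_map_act:
  assumes "g \<in> carrier G"
  shows "smooth_map A (points A) A (act g)"
proof -
  have "inj_on (snd \<xi>) (fst \<xi>)" if "\<xi> \<in> \<A>" for \<xi>
    using lie_group that by (simp add: lie_group_def smooth_manifold_def)
  moreover have "smooth_map (product_atlas \<A> A) (points \<A> \<times> points A) A (\<lambda>(g, m). act g m)"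
    using action by (simp add: smooth_transitive_action_def points_G)
  ultimately show ?thesis
    using smooth_map_slice[where B=\<A> and A=A and C=A and b=g and F="\<lambda>(g, m). act g m"] chart_inj assms points_G
    by simp
qed

lemma act_inv:
  assumes "g \<in> carrier G" "p \<in> points A"
  shows "act (inv\<^bsub>G\<^esub> g) (act g p) = p"
proof -
  have "act (inv\<^bsub>G\<^esub> g) (act g p) = act (inv\<^bsub>G\<^esub> g \<otimes>\<^bsub>G\<^esub> g) p"
    using composition_rule[OF assms(2) _ assms(1)] group.inv_closed[OF group_G assms(1)] by simp
  also have "\<dots> = p"
    using group.l_inv[OF group_G assms(1)] id_eq_one assms(2) by (metis restrict_apply')
  finally show ?thesis .
qed

lemma energy_velocity_act:
  assumes E: "invariant_energy G A act E" and \<gamma>: "smooth_map euclidean_atlas I A \<gamma>"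
    and g: "g \<in> carrier G" and t: "t \<in> I"
  shows "E (velocity A (act g \<circ> \<gamma>) t) = E (velocity A \<gamma> t)"
  unfolding velocity_smooth_map[OF smooth_map_act[OF g] \<gamma> t]
  using E g velocity_mem[OF \<gamma> t] by (simp add: invariant_energy_def)

text \<open>Translation by the one-parameter group \<open>c\<close> moves the curve along itself,
  \<open>\<delta>(s + r) = c(s) \<cdot> \<delta>(r)\<close>, so it carries the velocity at 0 to the velocity at \<open>s\<close>.\<close>

lemma energy_constant_along_homogeneous_curve:
  assumes E: "invariant_energy G A act E" and \<delta>: "regular_curve A (J, \<delta>)"
    and hom: "homogeneous_curve G \<A> act p0 (J, \<delta>)" and p0: "p0 \<in> points A"
    and s: "0 \<in> J" "s \<in> J"
  shows "E (velocity A \<delta> s) = E (velocity A \<delta> 0)"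
proof -
  note reg = regular_curveD[OF \<delta>]
  obtain X c where c: "is_exp_curve G \<A> X c" and \<delta>c: "\<And>t. t \<in> J \<Longrightarrow> \<delta> t = act (c t) p0"
    using hom by (auto simp: homogeneous_curve_def)
  have cG: "c t \<in> carrier G" for t
    using c points_G by (auto simp: is_exp_curve_def smooth_map_def)
  \<comment> \<open>near \<open>s\<close> the curve is its own germ at 0, shifted by \<open>s\<close> and translated by \<open>c s\<close>\<close>
  let ?\<theta> = "\<lambda>u. 1 * u + (- s)" and ?U = "J \<inter> {u. 1 * u + (- s) \<in> J}"
  have "open ?U"
    by (intro open_Int reg(1) open_affine_preimage)
  then have "velocity A \<delta> s = velocity A ((act (c s) \<circ> \<delta>) \<circ> ?\<theta>) s"
  proof (rule velocity_cong_open)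
    show "s \<in> ?U" using s by simp
    fix u assume "u \<in> ?U"
    then have u: "u \<in> J" "u - s \<in> J" by simp_all
    have "\<delta> u = act (c (s + (u - s))) p0" using \<delta>c[OF u(1)] by simp
    also have "c (s + (u - s)) = c s \<otimes>\<^bsub>G\<^esub> c (u - s)"
      using c unfolding is_exp_curve_def by blast
    also have "act (c s \<otimes>\<^bsub>G\<^esub> c (u - s)) p0 = act (c s) (\<delta> (u - s))"
      using composition_rule[OF p0 cG cG] \<delta>c[OF u(2)] by simp
    finally show "\<delta> u = ((act (c s) \<circ> \<delta>) \<circ> ?\<theta>) u" by simp
  qed
  also have "\<dots> = tangent_scale 1 (velocity A (act (c s) \<circ> \<delta>) (?\<theta> s))"
  proof (rule velocity_curve_reparam)
    show "smooth_map euclidean_atlas J A (act (c s) \<circ> \<delta>)"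
      by (rule smooth_map_curve[OF smooth_map_act[OF cG] reg(4)])
    show "?\<theta> s \<in> J" using s by simp
    show "(?\<theta> has_real_derivative 1) (at s)"
      by (auto intro!: derivative_eq_intros)
  qed
  finally show ?thesis
    using energy_velocity_act[OF E reg(4) cG s(1)] by simp
qed

text \<open>The geodesic orbit property speaks of geodesics that pass through \<open>p0\<close> at time 0. Any geodesic
  becomes one of these after a time shift and a translation, and neither affects the energy of its
  velocities.\<close>

lemma energy_constant_along_spray_geodesic:
  assumes E: "invariant_energy G A act E" and S: "geodesic_orbit_spray G \<A> A act p0 S"
    and p0: "p0 \<in> points A" and \<gamma>: "(I, \<gamma>) \<in> spray_geodesics A S" and st: "s \<in> I" "t \<in> I"
  shows "E (velocity A \<gamma> s) = E (velocity A \<gamma> t)"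
proof -
  have S': "spray A S" and inv: "invariant_spray G A act S"
    and geo: "\<And>J \<delta>. (J, \<delta>) \<in> spray_geodesics A S \<Longrightarrow> 0 \<in> J \<Longrightarrow> \<delta> 0 = p0 \<Longrightarrow>
      homogeneous_curve G \<A> act p0 (J, \<delta>)"
    using S unfolding geodesic_orbit_spray_def by auto
  have reg: "regular_curve A (I, \<gamma>)"
    using \<gamma> by (simp add: spray_geodesics_def)
  note sm = regular_curveD(4)[OF reg]
  have "\<gamma> t \<in> points A"
    using sm st(2) by (auto simp: smooth_curve_iff)
  then obtain g where g: "g \<in> carrier G" "act g (\<gamma> t) = p0"
    using unique_orbit[OF _ p0] by blast
  define \<theta> where "\<theta> = (\<lambda>u. 1 * u + t)"
  define J where "J = {u. 1 * u + t \<in> I}"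
  have "(I, act g \<circ> \<gamma>) \<in> spray_geodesics A S"
    by (rule spray_geodesic_image[OF S' smooth_map_act[OF g(1)]
          smooth_map_act[OF group.inv_closed[OF group_G g(1)]] act_inv[OF g(1)] _ \<gamma>])
      (use inv g(1) in \<open>auto simp: invariant_spray_def\<close>)
  then have \<delta>: "(J, (act g \<circ> \<gamma>) \<circ> \<theta>) \<in> spray_geodesics A S"
    unfolding J_def \<theta>_def by (rule spray_geodesic_affine[OF S']) simp
  have "E (velocity A ((act g \<circ> \<gamma>) \<circ> \<theta>) (s - t)) = E (velocity A ((act g \<circ> \<gamma>) \<circ> \<theta>) 0)"
  proof (rule energy_constant_along_homogeneous_curve[OF E _ geo[OF \<delta>] p0])
    show "regular_curve A (J, (act g \<circ> \<gamma>) \<circ> \<theta>)"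
      using \<delta> by (simp add: spray_geodesics_def)
    show "0 \<in> J" "0 \<in> J" "s - t \<in> J" "((act g \<circ> \<gamma>) \<circ> \<theta>) 0 = p0"
      using st g(2) by (simp_all add: J_def \<theta>_def)
  qed
  moreover have "E (velocity A ((act g \<circ> \<gamma>) \<circ> \<theta>) u) = E (velocity A \<gamma> (u + t))" if "u + t \<in> I" for u
  proof -
    have "velocity A ((act g \<circ> \<gamma>) \<circ> \<theta>) u = tangent_scale 1 (velocity A (act g \<circ> \<gamma>) (\<theta> u))"
      by (rule velocity_curve_reparam[OF smooth_map_curve[OF smooth_map_act[OF g(1)] sm]])
        (use that in \<open>auto simp: \<theta>_def intro!: derivative_eq_intros\<close>)
    then show ?thesis
      using energy_velocity_act[OF E sm g(1) that] by (simp add: \<theta>_def)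
  qed
  ultimately show ?thesis
    using st by simp
qed

end

section \<open>Reparametrizations between curves of constant energy\<close>

context smooth_atlas
begin

text \<open>The energies satisfy \<open>E((\<gamma> \<circ> \<theta>)') = \<theta>'\<^sup>2 E(\<gamma>' \<circ> \<theta>)\<close>. If both are constant, so is \<open>\<theta>'\<close>,
  as energies of nonzero vectors are positive and \<open>\<theta>' > 0\<close>.\<close>

lemma reparam_affine:
  assumes E: "finsler_metric A E" and \<gamma>: "regular_curve A (I, \<gamma>)" and \<gamma>\<theta>: "regular_curve A (J, \<gamma> \<circ> \<theta>)"
    and \<theta>: "orientation_preserving_reparam \<theta> J I"
    and const: "\<And>s t. s \<in> I \<Longrightarrow> t \<in> I \<Longrightarrow> E (velocity A \<gamma> s) = E (velocity A \<gamma> t)"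
    and const': "\<And>s t. s \<in> J \<Longrightarrow> t \<in> J \<Longrightarrow> E (velocity A (\<gamma> \<circ> \<theta>) s) = E (velocity A (\<gamma> \<circ> \<theta>) t)"
  obtains a b where "a > 0" "\<And>t. t \<in> J \<Longrightarrow> \<theta> t = a * t + b"
proof -
  note reg = regular_curveD[OF \<gamma>] and reg' = regular_curveD[OF \<gamma>\<theta>]
  obtain t0 where t0: "t0 \<in> J" using reg'(3) by blast
  have \<theta>I: "\<theta> t \<in> I" if "t \<in> J" for t
    using \<theta> that by (auto simp: orientation_preserving_reparam_def bij_betw_def)
  have D: "(\<theta> has_real_derivative deriv \<theta> t) (at t)" and pos: "deriv \<theta> t > 0" if "t \<in> J" for t
    using \<theta> that smooth_on_imp_differentiable[of J \<theta> t]
    by (simp_all add: orientation_preserving_reparam_def DERIV_deriv_iff_real_differentiable)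
  have energy: "E (velocity A (\<gamma> \<circ> \<theta>) t) = (deriv \<theta> t)\<^sup>2 * E (velocity A \<gamma> (\<theta> t))" if "t \<in> J" for t
    using velocity_curve_reparam[OF reg(4) \<theta>I[OF that] D[OF that]] velocity_mem[OF reg(4) \<theta>I[OF that]]
      pos[OF that] E by (simp add: finsler_metric_def)
  define a where "a = deriv \<theta> t0"
  have a: "a > 0" using pos[OF t0] by (simp add: a_def)
  have deriv: "deriv \<theta> t = a" if t: "t \<in> J" for t
  proof -
    have "(deriv \<theta> t)\<^sup>2 * E (velocity A \<gamma> (\<theta> t)) = E (velocity A (\<gamma> \<circ> \<theta>) t)"
      by (simp only: energy[OF t])
    also have "\<dots> = E (velocity A (\<gamma> \<circ> \<theta>) t0)"
      by (rule const'[OF t t0])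
    also have "\<dots> = a\<^sup>2 * E (velocity A \<gamma> (\<theta> t0))"
      by (simp only: energy[OF t0] a_def)
    also have "E (velocity A \<gamma> (\<theta> t0)) = E (velocity A \<gamma> (\<theta> t))"
      by (rule const[OF \<theta>I[OF t0] \<theta>I[OF t]])
    finally have "(deriv \<theta> t)\<^sup>2 * E (velocity A \<gamma> (\<theta> t)) = a\<^sup>2 * E (velocity A \<gamma> (\<theta> t))" .
    moreover have "E (velocity A \<gamma> (\<theta> t)) > 0"
      by (rule energy_positive[OF E reg(5)[OF \<theta>I[OF t]]])
    ultimately have "(deriv \<theta> t)\<^sup>2 = a\<^sup>2" by simp
    then show ?thesis
      using pos[OF t] a by (simp add: power2_eq_iff_nonneg)
  qed
  have "((\<lambda>t. \<theta> t - a * t) has_real_derivative 0) (at t within J)" if "t \<in> J" for t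
    using has_field_derivative_at_within[OF DERIV_diff[OF D[OF that] DERIV_cmult_Id[of a]]]
    by (simp add: deriv[OF that])
  then obtain b where "\<And>t. t \<in> J \<Longrightarrow> \<theta> t - a * t = b"
    using has_field_derivative_zero_constant[OF is_interval_convex[OF reg'(2)], of "\<lambda>t. \<theta> t - a * t"]
    by blast
  then show thesis
    using that[OF a, of b] by (simp add: algebra_simps)
qed

text \<open>The map of a curve is arbitrary outside its interval, and undoing \<open>\<theta>\<close> gives back \<open>\<gamma>\<close> on \<open>I\<close>
  only. Hence the assumption that the family is closed under changes outside the interval.\<close>

lemma undo_affine_reparam:
  assumes affine: "\<And>I \<gamma> a b. (I, \<gamma>) \<in> \<F> \<Longrightarrow> a > 0 \<Longrightarrow>
      ({t::real. a * t + b \<in> I}, \<gamma> \<circ> (\<lambda>t. a * t + b)) \<in> \<F>"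
    and cong: "\<And>I \<gamma> \<delta>. (I, \<gamma>) \<in> \<F> \<Longrightarrow> (\<And>t. t \<in> I \<Longrightarrow> \<gamma> t = \<delta> t) \<Longrightarrow> (I, \<delta>) \<in> \<F>"
    and \<gamma>\<theta>: "(J, \<gamma> \<circ> \<theta>) \<in> \<F>" and \<theta>: "\<theta> ` J = I"
    and a: "a > 0" and eq: "\<And>t. t \<in> J \<Longrightarrow> \<theta> t = a * t + b"
  shows "(I, \<gamma>) \<in> \<F>"
proof -
  let ?\<tau> = "\<lambda>s. (1 / a) * s + (- b / a)"
  have inverse: "a * ?\<tau> s + b = s" "?\<tau> (a * s + b) = s" for s
    using a by (simp_all add: field_simps)
  have "{s. ?\<tau> s \<in> J} = I"
  proof (intro equalityI subsetI)
    fix s assume "s \<in> {s. ?\<tau> s \<in> J}"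
    then have t: "?\<tau> s \<in> J" by simp
    have "s = \<theta> (?\<tau> s)" by (simp only: eq[OF t] inverse(1))
    with t \<theta> show "s \<in> I" by blast
  next
    fix s assume "s \<in> I"
    then obtain t where "t \<in> J" "s = a * t + b"
      using \<theta> eq by auto
    then show "s \<in> {s. ?\<tau> s \<in> J}"
      using inverse(2)[of t] by simp
  qed
  then have "(I, (\<gamma> \<circ> \<theta>) \<circ> ?\<tau>) \<in> \<F>"
    using affine[OF \<gamma>\<theta>, of "1 / a" "- b / a"] a by simp
  then show ?thesis
  proof (rule cong)
    fix s assume "s \<in> I"
    then have "?\<tau> s \<in> J" using \<open>{s. ?\<tau> s \<in> J} = I\<close> by blast
    then show "((\<gamma> \<circ> \<theta>) \<circ> ?\<tau>) s = \<gamma> s"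
      using eq[of "?\<tau> s"] inverse(1)[of s] by simp
  qed
qed

end

lemma projectively_equivalent_refl:
  "projectively_equivalent \<F> \<F>"
proof -
  have "orientation_preserving_reparam (\<lambda>t. t) I I" for I
    using smooth_on_affine[of I 1 0] by (simp add: orientation_preserving_reparam_def bij_betw_def)
  then show ?thesis
    unfolding projectively_equivalent_def comp_def by fastforce
qed

section \<open>Metrizability of geodesic orbit sprays\<close>

context homogeneous_manifold
begin

text \<open>A geodesic of either family has a reparametrization in the other one. Both curves have constant
  energy, so the reparametrization is affine and can be undone within the other family.\<close>

lemma energy_geodesics_eq_spray_geodesics:
  assumes p0: "p0 \<in> points A" and S: "geodesic_orbit_spray G \<A> A act p0 S"
    and E: "finsler_metric A E" "invariant_energy G A act E"
    and proj: "projectively_equivalent (energy_geodesics A E) (spray_geodesics A S)"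
  shows "energy_geodesics A E = spray_geodesics A S"
proof -
  have S': "spray A S" using S by (simp add: geodesic_orbit_spray_def)
  note const_E = energy_constant_along_energy_geodesic[OF E(1)]
  note const_S = energy_constant_along_spray_geodesic[OF E(2) S p0]
  have reg_E: "regular_curve A c" if "c \<in> energy_geodesics A E" for c
    using that by (auto simp: energy_geodesics_def)
  have reg_S: "regular_curve A c" if "c \<in> spray_geodesics A S" for c
    using that by (auto simp: spray_geodesics_def)
  have "(I, \<gamma>) \<in> spray_geodesics A S" if \<gamma>: "(I, \<gamma>) \<in> energy_geodesics A E" for I \<gamma>
  proof -
    obtain J \<theta> where \<theta>: "orientation_preserving_reparam \<theta> J I" "(J, \<gamma> \<circ> \<theta>) \<in> spray_geodesics A S"
      using proj \<gamma> unfolding projectively_equivalent_def by blast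
    obtain a b where ab: "0 < a" "\<And>t. t \<in> J \<Longrightarrow> \<theta> t = a * t + b"
      using reparam_affine[OF E(1) reg_E[OF \<gamma>] reg_S[OF \<theta>(2)] \<theta>(1) const_E[OF \<gamma>] const_S[OF \<theta>(2)]]
      by blast
    have im: "\<theta> ` J = I"
      using \<theta>(1) by (simp add: orientation_preserving_reparam_def bij_betw_def)
    show ?thesis
    proof (rule undo_affine_reparam[OF _ _ \<theta>(2) im ab])
      show "({t. a * t + b \<in> I}, \<gamma> \<circ> (\<lambda>t. a * t + b)) \<in> spray_geodesics A S"
        if "(I, \<gamma>) \<in> spray_geodesics A S" "0 < a" for I \<gamma> a b
        by (rule spray_geodesic_affine[OF S' that])
      show "(I, \<delta>) \<in> spray_geodesics A S"
        if "(I, \<gamma>) \<in> spray_geodesics A S" "\<And>t. t \<in> I \<Longrightarrow> \<gamma> t = \<delta> t" for I \<gamma> \<delta>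
        by (rule spray_geodesic_cong[OF that])
    qed
  qed
  moreover have "(I, \<gamma>) \<in> energy_geodesics A E" if \<gamma>: "(I, \<gamma>) \<in> spray_geodesics A S" for I \<gamma>
  proof -
    obtain J \<theta> where \<theta>: "orientation_preserving_reparam \<theta> J I" "(J, \<gamma> \<circ> \<theta>) \<in> energy_geodesics A E"
      using proj \<gamma> unfolding projectively_equivalent_def by blast
    obtain a b where ab: "0 < a" "\<And>t. t \<in> J \<Longrightarrow> \<theta> t = a * t + b"
      using reparam_affine[OF E(1) reg_S[OF \<gamma>] reg_E[OF \<theta>(2)] \<theta>(1) const_S[OF \<gamma>] const_E[OF \<theta>(2)]]
      by blast
    have im: "\<theta> ` J = I"
      using \<theta>(1) by (simp add: orientation_preserving_reparam_def bij_betw_def)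
    show ?thesis
    proof (rule undo_affine_reparam[OF _ _ \<theta>(2) im ab])
      show "({t. a * t + b \<in> I}, \<gamma> \<circ> (\<lambda>t. a * t + b)) \<in> energy_geodesics A E"
        if "(I, \<gamma>) \<in> energy_geodesics A E" "0 < a" for I \<gamma> a b
        by (rule energy_geodesic_affine[OF E(1) that])
      show "(I, \<delta>) \<in> energy_geodesics A E"
        if "(I, \<gamma>) \<in> energy_geodesics A E" "\<And>t. t \<in> I \<Longrightarrow> \<gamma> t = \<delta> t" for I \<gamma> \<delta>
        by (rule energy_geodesic_cong[OF that])
    qed
  qed
  ultimately show ?thesis by auto
qed

lemma invariant_projectively_metrizable_iff:
  assumes "p0 \<in> points A" "geodesic_orbit_spray G \<A> A act p0 S"
    and "\<And>E. P A E \<Longrightarrow> finsler_metric A E"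
  shows "invariant_projectively_metrizable P G A act S \<longleftrightarrow> invariant_metrizable P G A act S"
proof
  assume "invariant_projectively_metrizable P G A act S"
  then obtain E where "P A E" "invariant_energy G A act E"
    "projectively_equivalent (energy_geodesics A E) (spray_geodesics A S)"
    unfolding invariant_projectively_metrizable_def by blast
  moreover from this have "energy_geodesics A E = spray_geodesics A S"
    by (intro energy_geodesics_eq_spray_geodesics[OF assms(1,2) assms(3)])
  ultimately show "invariant_metrizable P G A act S"
    unfolding invariant_metrizable_def by blast
next
  assume "invariant_metrizable P G A act S"
  then obtain E where "P A E" "invariant_energy G A act E"
    "energy_geodesics A E = spray_geodesics A S"
    unfolding invariant_metrizable_def by blast
  then show "invariant_projectively_metrizable P G A act S"
    unfolding invariant_projectively_metrizable_def using projectively_equivalent_refl by metis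
qed

end

theorem proposition5p5:
  fixes G :: "('g, 'x) monoid_scheme"
    and \<A> :: "('g, 'h::euclidean_space) atlas"
    and M :: "('a, 'e::euclidean_space) atlas"
    and act :: "'g \<Rightarrow> 'a \<Rightarrow> 'a"
    and p0 :: 'a
    and S :: "('a, 'e) spray_field"
  assumes "lie_group G \<A>"
    and "smooth_manifold M"
    and "connected_space (manifold_topology M)"
    and "smooth_transitive_action G \<A> M act"
    and "p0 \<in> points M"
    and "geodesic_orbit_spray G \<A> M act p0 S"
  shows "(invariant_projectively_metrizable riemannian_metric G M act S \<longleftrightarrow>
            invariant_metrizable riemannian_metric G M act S) \<and>
         (invariant_projectively_metrizable finsler_metric G M act S \<longleftrightarrow>
            invariant_metrizable finsler_metric G M act S)"
proof -
  interpret homogeneous_manifold M G \<A> act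
    by unfold_locales (use assms in simp_all)
  show ?thesis
    using invariant_projectively_metrizable_iff[OF assms(5,6), of riemannian_metric]
      invariant_projectively_metrizable_iff[OF assms(5,6), of finsler_metric]
    by (simp add: riemannian_metric_def)
qed

end
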